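(* Let $N\ge1$, $T>0$, $l_1,\dots,l_{N+1}>0$, $m_1,\dots,m_N>0$, and consider the associated finite Krein--Stieltjes string dynamical system described in the context. For $k=1,\dots,N$ let $f_k^T\in\mathcal{F}^T_1$ be the control with $W^Tf_k^T=d_k$, where $d_k=(0,\dots,0,\frac1{m_k},0,\dots,0)$ (nonzero entry at the $k$-th place). Then the parameters of the string can be recovered by $$l_1=-\frac{\|f_1^T\|^2_{L_2(0,T)}}{(f_1^T)'(T)},\qquad m_k=\frac{1}{(C^Tf_k^T,f_k^T)_{L_2(0,T)}},\quad k=1,\dots,N,$$ $$b_k=m_k^2\left((C^Tf_k^T)'',f_k^T\right)_{L_2(0,T)},\quad k=1,\dots,N.$$
   Context: All functions and spaces are real. Given $l_1,\dots,l_{N+1}>0$ (distances between masses) and $m_1,\dots,m_N>0$ (point masses), put $a_i=\frac1{l_{i+1}}$ for $i=1,\dots,N-1$ and $b_i=-\frac{l_i+l_{i+1}}{l_il_{i+1}}$ for $i=1,\dots,N$. Let $A$ be the symmetric tridiagonal $N\times N$ matrix with diagonal $b_1,\dots,b_N$ and off-diagonal entries $a_1,\dots,a_{N-1}$, and $M=\operatorname{diag}(m_1,\dots,m_N)$. The dynamical system is $Mu_{tt}=Au+\widetilde f$, $t>0$, $u(0)=u_t(0)=0$, with $u(t)\in\mathbb{R}^N$, $\widetilde f=(f/l_1,0,\dots,0)$, $f\in\mathcal{F}^T:=L_2(0,T)$; its solution is denoted $u^f$. The generalized eigenvalue problem $A\varphi=\lambda M\varphi$ has $N$ distinct negative eigenvalues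 $\lambda_1,\dots,\lambda_N$; $\varphi_k$ is the eigenvector for $\lambda_k$ with first component $1$, and $\rho_k=(M\varphi_k,\varphi_k)_{\mathbb{R}^N}$. The solution has the form $u^f(t)=\sum_{k=1}^N\frac{1}{l_1\rho_k}\int_0^tf(\tau)\frac{\sin\sqrt{|\lambda_k|}(t-\tau)}{\sqrt{|\lambda_k|}}\,d\tau\,\varphi_k$. The state space $\mathcal{H}^N$ is $\mathbb{R}^N$ with inner product $(a,b)_{\mathcal{H}^N}=(Ma,b)_{\mathbb{R}^N}$. The control operator is $W^T:\mathcal{F}^T\to\mathcal{H}^N$, $W^Tf=u^f(T)$; the connecting operator is $C^T=(W^T)^*W^T:\mathcal{F}^T\to\mathcal{F}^T$ (adjoint with respect to these inner products), i.e. $(C^Tf,g)_{L_2(0,T)}=(Mu^f(T),u^g(T))_{\mathbb{R}^N}$. Finally $\mathcal{F}^T_1=\operatorname{span}\left\{\frac{\sin\sqrt{|\lambda_k|}(T-\cdot)}{\sqrt{|\lambda_k|}}\right\}_{k=1}^N$, whose elements are smooth functions on $[0,T]$. The restriction of $W^T$ to $\mathcal{F}^T_1$ is an isomorphism onto $\mathcal{H}^N$, so the controls $f_k^T$ exist and are unique. Primes denote derivatives in $t$. *)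

theory Defs
  imports "HOL-Analysis.Analysis" "Jordan_Normal_Form.Matrix"
begin

text \<open>
  The sequences \<open>l\<close> and \<open>m\<close> carry the indices \<open>1..N+1\<close> and \<open>1..N\<close> of the string, whereas
  matrix and vector positions start at \<open>0\<close>: position \<open>i\<close> belongs to the mass \<open>m (i + 1)\<close>.
\<close>

definition string_a :: "(nat \<Rightarrow> real) \<Rightarrow> nat \<Rightarrow> real" where
  "string_a l i = 1 / l (i + 1)"

definition string_b :: "(nat \<Rightarrow> real) \<Rightarrow> nat \<Rightarrow> real" where
  "string_b l i = - ((l i + l (i + 1)) / (l i * l (i + 1)))"

definition string_A :: "nat \<Rightarrow> (nat \<Rightarrow> real) \<Rightarrow> real mat" where
  "string_A N l = Matrix.mat N N (\<lambda>(i, j).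
     if i = j then string_b l (i + 1)
     else if j = i + 1 then string_a l (i + 1)
     else if i = j + 1 then string_a l (j + 1)
     else 0)"

definition string_M :: "nat \<Rightarrow> (nat \<Rightarrow> real) \<Rightarrow> real mat" where
  "string_M N m = Matrix.mat N N (\<lambda>(i, j). if i = j then m (i + 1) else 0)"

definition string_force :: "nat \<Rightarrow> (nat \<Rightarrow> real) \<Rightarrow> real \<Rightarrow> real Matrix.vec" where
  "string_force N l x = Matrix.vec N (\<lambda>i. if i = 0 then x / l 1 else 0)"

definition state_inner :: "nat \<Rightarrow> (nat \<Rightarrow> real) \<Rightarrow> real Matrix.vec \<Rightarrow> real Matrix.vec \<Rightarrow> real" where
  "state_inner N m a b = scalar_prod (string_M N m *\<^sub>v a) b"

text \<open>
  Elements of \<open>L\<^sub>2(0,T)\<close> are represented by functions \<open>real \<Rightarrow> real\<close>; only the values on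
  \<open>(0,T)\<close> up to null sets matter.
\<close>

definition L2 :: "real \<Rightarrow> (real \<Rightarrow> real) set" where
  "L2 T = {f. f \<in> borel_measurable (lebesgue_on {0<..<T}) \<and>
              integrable (lebesgue_on {0<..<T}) (\<lambda>t. (f t)\<^sup>2)}"

definition L2_inner :: "real \<Rightarrow> (real \<Rightarrow> real) \<Rightarrow> (real \<Rightarrow> real) \<Rightarrow> real" where
  "L2_inner T f g = (LINT t|lebesgue_on {0<..<T}. f t * g t)"

definition L2_norm :: "real \<Rightarrow> (real \<Rightarrow> real) \<Rightarrow> real" where
  "L2_norm T f = sqrt (L2_inner T f f)"

text \<open>
  As the control is only square integrable, \<open>M u\<^sub>t\<^sub>t = A u + f\<close> is understood almost
  everywhere: \<open>u\<close> is differentiable with derivative \<open>v\<close>, and \<open>v\<close> is absolutely continuous,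
  i.e. an indefinite integral of an integrable \<open>w\<close>, which is \<open>u\<^sub>t\<^sub>t\<close>.
\<close>

definition is_string_solution ::
  "nat \<Rightarrow> (nat \<Rightarrow> real) \<Rightarrow> (nat \<Rightarrow> real) \<Rightarrow> real \<Rightarrow> (real \<Rightarrow> real) \<Rightarrow> (real \<Rightarrow> real Matrix.vec) \<Rightarrow> bool" where
  "is_string_solution N l m T f u \<longleftrightarrow>
     (\<forall>t\<in>{0..T}. u t \<in> carrier_vec N) \<and>
     (\<exists>v w :: real \<Rightarrow> real Matrix.vec.
        (\<forall>t\<in>{0..T}. v t \<in> carrier_vec N \<and> w t \<in> carrier_vec N) \<and>
        u 0 = 0\<^sub>v N \<and> v 0 = 0\<^sub>v N \<and>
        (\<forall>i<N. \<forall>t\<in>{0..T}.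
           ((\<lambda>s. vec_index (u s) i) has_real_derivative vec_index (v t) i) (at t within {0..T})) \<and>
        (\<forall>i<N. integrable (lebesgue_on {0..T}) (\<lambda>s. vec_index (w s) i)) \<and>
        (\<forall>i<N. \<forall>t\<in>{0..T}.
           vec_index (v t) i = vec_index (v 0) i + (LINT s|lebesgue_on {0..t}. vec_index (w s) i)) \<and>
        (AE t in lebesgue_on {0..T}.
           string_M N m *\<^sub>v w t = string_A N l *\<^sub>v u t + string_force N l (f t)))"

text \<open>
  Functions on \<open>[0,T]\<close> are made unique as total functions by membership in
  \<^term>\<open>extensional {0..T}\<close>.
\<close>

definition string_solution ::
  "nat \<Rightarrow> (nat \<Rightarrow> real) \<Rightarrow> (nat \<Rightarrow> real) \<Rightarrow> real \<Rightarrow> (real \<Rightarrow> real) \<Rightarrow> real \<Rightarrow> real Matrix.vec" where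
  "string_solution N l m T f =
     (THE u. u \<in> extensional {0..T} \<and> is_string_solution N l m T f u)"

definition control_op ::
  "nat \<Rightarrow> (nat \<Rightarrow> real) \<Rightarrow> (nat \<Rightarrow> real) \<Rightarrow> real \<Rightarrow> (real \<Rightarrow> real) \<Rightarrow> real Matrix.vec" where
  "control_op N l m T f = string_solution N l m T f T"

text \<open>
  The adjoint takes its values in \<open>L\<^sub>2(0,T)\<close>, i.e. in classes modulo null sets; derivatives of
  its values refer to the continuous representative, which is the one selected here.
\<close>

definition control_op_adj ::
  "nat \<Rightarrow> (nat \<Rightarrow> real) \<Rightarrow> (nat \<Rightarrow> real) \<Rightarrow> real \<Rightarrow> real Matrix.vec \<Rightarrow> real \<Rightarrow> real" where
  "control_op_adj N l m T a =
     (THE h. h \<in> extensional {0..T} \<and> continuous_on {0..T} h \<and> h \<in> L2 T \<and>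
        (\<forall>g\<in>L2 T. L2_inner T h g = state_inner N m a (control_op N l m T g)))"

definition connecting_op ::
  "nat \<Rightarrow> (nat \<Rightarrow> real) \<Rightarrow> (nat \<Rightarrow> real) \<Rightarrow> real \<Rightarrow> (real \<Rightarrow> real) \<Rightarrow> real \<Rightarrow> real" where
  "connecting_op N l m T f = control_op_adj N l m T (control_op N l m T f)"

definition string_eigenvalues :: "nat \<Rightarrow> (nat \<Rightarrow> real) \<Rightarrow> (nat \<Rightarrow> real) \<Rightarrow> real set" where
  "string_eigenvalues N l m =
     {lam. \<exists>\<phi>\<in>carrier_vec N. \<phi> \<noteq> 0\<^sub>v N \<and> string_A N l *\<^sub>v \<phi> = lam \<cdot>\<^sub>v (string_M N m *\<^sub>v \<phi>)}"

text \<open>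
  The span of finitely many functions on \<open>[0,T]\<close>, indexed by the (finitely many) eigenvalues.
\<close>

definition F1 :: "nat \<Rightarrow> (nat \<Rightarrow> real) \<Rightarrow> (nat \<Rightarrow> real) \<Rightarrow> real \<Rightarrow> (real \<Rightarrow> real) set" where
  "F1 N l m T = {f. \<exists>c. \<forall>t\<in>{0..T}.
     f t = (\<Sum>lam\<in>string_eigenvalues N l m. c lam * (sin (sqrt \<bar>lam\<bar> * (T - t)) / sqrt \<bar>lam\<bar>))}"

definition delta_state :: "nat \<Rightarrow> (nat \<Rightarrow> real) \<Rightarrow> nat \<Rightarrow> real Matrix.vec" where
  "delta_state N m k = Matrix.vec N (\<lambda>i. if i + 1 = k then 1 / m k else 0)"

text \<open>Derivative of a function on \<open>[0,T]\<close>, one-sided at the end points.\<close>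

definition tderiv :: "real \<Rightarrow> (real \<Rightarrow> real) \<Rightarrow> real \<Rightarrow> real" where
  "tderiv T h t = vector_derivative h (at t within {0..T})"

end

theory Submission
  imports Defs
begin

text \<open>
  Everything rests on one Green-type identity. Call \<open>q\<close> a free motion with initial velocity
  \<open>a\<close> if \<open>M q'' = A q\<close>, \<open>q(0) = 0\<close>, \<open>q'(0) = a\<close>. Pairing a controlled motion \<open>u\<close> with the
  time-reversed free motion \<open>q(t - s)\<close> and using the symmetry of \<open>A\<close> gives
  \<open>(M u(t), a) = \<integral>\<^sub>0\<^sup>t q\<^sub>1(t - s) / l\<^sub>1 f(s) ds\<close> (\<open>string_solution_pairing\<close>). This determines
  \<open>u(t)\<close>, because \<open>a\<close> is arbitrary, and at \<open>t = T\<close> it says that the adjoint of the control operator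
  is \<open>a \<mapsto> q\<^sub>1(T - \<cdot>) / l\<^sub>1\<close> (\<open>control_op_adj_eq\<close>).

  The three formulas follow. Pairing \<open>W\<^sup>* d\<^sub>k\<close> with \<open>f\<^sub>k\<close> gives \<open>(M d\<^sub>k, d\<^sub>k) = 1 / m\<^sub>k\<close>.
  Two time derivatives turn the free motion \<open>q\<close> into its acceleration \<open>M\<^sup>-\<^sup>1 A q\<close>, again a
  free motion (\<open>free_motion_acceleration\<close>), so that \<open>(W\<^sup>* d\<^sub>k)'' = W\<^sup>* (M\<^sup>-\<^sup>1 A d\<^sub>k)\<close>, and its pairing
  with \<open>f\<^sub>k\<close> is \<open>(A d\<^sub>k, d\<^sub>k) = b\<^sub>k / m\<^sub>k\<^sup>2\<close>. Finally \<open>f\<^sub>1\<close> lies in the sine space, hence is itself of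
  the form \<open>W\<^sup>* x\<close> (\<open>F1_free_motion\<close>): its squared norm is \<open>(M x, d\<^sub>1) = x\<^sub>1\<close>, its derivative at \<open>T\<close>
  is \<open>- x\<^sub>1 / l\<^sub>1\<close>, and \<open>x\<^sub>1 \<noteq> 0\<close> because the zero control cannot reach \<open>d\<^sub>1\<close>.

  Two analytic facts carry the identity: integration by parts against a control that is only
  integrable (\<open>absolutely_continuous_integration_by_parts\<close>), and solvability of the linear system with
  such a forcing, by a series of iterated integrals (\<open>linear_second_order_system_solvable\<close>). The only
  spectral input is that eigenvalues are negative and eigenvectors have nonzero first component;
  both come from running the three-term recurrence along the string.
\<close>

section \<open>Integration by parts for indefinite integrals\<close>

text \<open>
  Continuity of \<open>V\<close> makes the difference quotients of \<open>\<Phi>\<close> tend to \<open>0\<close> at every point. In the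
  integration by parts \<open>V\<close> is a multiple of the indefinite integral of \<open>\<bar>f\<bar>\<close>.
\<close>

lemma constant_if_increment_bounded:
  fixes \<Phi> V :: "real \<Rightarrow> real"
  assumes "a \<le> b" and V: "continuous_on {a..b} V"
    and bd: "\<And>s t. a \<le> s \<Longrightarrow> s \<le> t \<Longrightarrow> t \<le> b \<Longrightarrow> \<bar>\<Phi> t - \<Phi> s\<bar> \<le> (t - s) * (V t - V s)"
  shows "\<Phi> b = \<Phi> a"
proof -
  have "(\<Phi> has_field_derivative 0) (at x within {a..b})" if x: "x \<in> {a..b}" for x
    unfolding has_field_derivative_iff
  proof (rule Lim_null_comparison)
    have "norm ((\<Phi> y - \<Phi> x) / (y - x)) \<le> \<bar>V y - V x\<bar>" if y: "y \<in> {a..b}" for y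
    proof -
      have "\<bar>\<Phi> y - \<Phi> x\<bar> \<le> \<bar>y - x\<bar> * \<bar>V y - V x\<bar>"
      proof (cases "x \<le> y")
        case True
        with bd[of x y] x y have "\<bar>\<Phi> y - \<Phi> x\<bar> \<le> (y - x) * (V y - V x)" by auto
        also have "\<dots> \<le> \<bar>y - x\<bar> * \<bar>V y - V x\<bar>" by (metis abs_ge_self abs_mult)
        finally show ?thesis .
      next
        case False
        with bd[of y x] x y have "\<bar>\<Phi> x - \<Phi> y\<bar> \<le> (x - y) * (V x - V y)" by auto
        also have "\<dots> \<le> \<bar>x - y\<bar> * \<bar>V x - V y\<bar>" by (metis abs_ge_self abs_mult)
        finally show ?thesis by (simp add: abs_minus_commute)
      qed
      then show ?thesis
        by (cases "y = x") (auto simp: abs_divide divide_le_eq mult.commute)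
    qed
    then show "\<forall>\<^sub>F y in at x within {a..b}. norm ((\<Phi> y - \<Phi> x) / (y - x)) \<le> \<bar>V y - V x\<bar>"
      by (simp add: eventually_at_filter)
    have "(V \<longlongrightarrow> V x) (at x within {a..b})"
      using V x by (simp add: continuous_on)
    then show "((\<lambda>y. \<bar>V y - V x\<bar>) \<longlongrightarrow> 0) (at x within {a..b})"
      using LIM_zero tendsto_rabs_zero by blast
  qed
  then have "\<exists>c. \<forall>x\<in>{a..b}. \<Phi> x = c"
    by (intro has_field_derivative_zero_constant) auto
  then show ?thesis using \<open>a \<le> b\<close> by force
qed

lemma integral_diff_Icc:
  fixes h :: "real \<Rightarrow> real"
  assumes "h integrable_on {a..b}" "a \<le> s" "s \<le> t" "t \<le> b"
  shows "integral {a..t} h - integral {a..s} h = integral {s..t} h"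
proof -
  have "h integrable_on {a..t}"
    by (rule integrable_on_subinterval[OF assms(1)]) (use assms in auto)
  then show ?thesis
    using Henstock_Kurzweil_Integration.integral_combine[of a s t h] assms by simp
qed

lemma absolutely_integrable_mult_continuous:
  fixes f g :: "real \<Rightarrow> real"
  assumes "f absolutely_integrable_on {a..b}" "continuous_on {a..b} g"
  shows "(\<lambda>s. g s * f s) absolutely_integrable_on {a..b}"
  by (rule absolutely_integrable_bounded_measurable_product_real)
    (use assms in \<open>auto intro!: compact_imp_bounded compact_continuous_image
       continuous_imp_measurable_on_sets_lebesgue\<close>)

text \<open>
  The defect \<open>\<Phi>\<close> between the two sides, as a function of the upper limit, changes between \<open>s\<close> and \<open>t\<close> by
  \<open>\<integral> (g(r) - g(t)) f(r) dr + \<integral> g'(r) (F(r) - F(s)) dr\<close>. Each term is at most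
  \<open>L (t - s) \<integral>\<bar>f\<bar>\<close> over \<open>[s, t]\<close>, with \<open>L\<close> a bound of \<open>\<bar>g'\<bar>\<close>, so \<open>\<Phi>\<close> is constant.
\<close>

lemma absolutely_continuous_integration_by_parts:
  fixes f g g' :: "real \<Rightarrow> real"
  assumes ab: "a \<le> b" and f: "f absolutely_integrable_on {a..b}"
    and g: "\<And>t. t \<in> {a..b} \<Longrightarrow> (g has_real_derivative g' t) (at t within {a..b})"
    and g': "continuous_on {a..b} g'"
  shows "integral {a..b} (\<lambda>s. g s * f s) =
    g b * integral {a..b} f - integral {a..b} (\<lambda>s. g' s * integral {a..s} f)"
proof -
  define F where "F s = integral {a..s} f" for s
  define V where "V s = integral {a..s} (\<lambda>r. \<bar>f r\<bar>)" for s
  define \<Phi> where "\<Phi> t = integral {a..t} (\<lambda>s. g s * f s) + integral {a..t} (\<lambda>s. g' s * F s) - g t * F t" for t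
  have gc: "continuous_on {a..b} g"
    by (rule DERIV_continuous_on) (use g in auto)
  have f1: "f integrable_on {a..b}" and f2: "(\<lambda>r. \<bar>f r\<bar>) integrable_on {a..b}"
    using f by (auto simp: absolutely_integrable_on_def)
  have Fc: "continuous_on {a..b} F" and Vc: "continuous_on {a..b} V"
    unfolding F_def V_def by (auto intro: indefinite_integral_continuous_1 f1 f2)
  have gf: "(\<lambda>s. g s * f s) integrable_on {a..b}"
    using absolutely_integrable_mult_continuous[OF f gc] set_lebesgue_integral_eq_integral(1) by blast
  have gF: "(\<lambda>s. g' s * F s) integrable_on {a..b}"
    by (intro integrable_continuous_interval continuous_intros g' Fc)
  obtain L where L: "L \<ge> 0" "\<And>t. t \<in> {a..b} \<Longrightarrow> \<bar>g' t\<bar> \<le> L"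
  proof -
    have "bounded (g' ` {a..b})" by (intro compact_imp_bounded compact_continuous_image g') auto
    then obtain L where "L > 0" "\<And>t. t \<in> {a..b} \<Longrightarrow> \<bar>g' t\<bar> \<le> L" unfolding bounded_pos by auto
    then show thesis using that[of L] by auto
  qed
  have "\<Phi> b = \<Phi> a"
  proof (rule constant_if_increment_bounded[OF ab])
    show "continuous_on {a..b} (\<lambda>t. 2 * L * V t)" by (intro continuous_intros Vc)
    fix s t assume st: "a \<le> s" "s \<le> t" "t \<le> b"
    have sub: "{s..t} \<subseteq> {a..b}" using st by auto
    note int = integrable_on_subinterval[OF _ sub]
    have Vd: "integral {s..r} (\<lambda>r. \<bar>f r\<bar>) = V r - V s" if "s \<le> r" "r \<le> t" for r
      unfolding V_def using integral_diff_Icc[OF f2, of s r] st that by simp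
    have Fd: "integral {s..r} f = F r - F s" if "s \<le> r" "r \<le> t" for r
      unfolding F_def using integral_diff_Icc[OF f1, of s r] st that by simp
    have g'_int: "(g' has_integral (g t - g s)) {s..t}"
    proof (rule fundamental_theorem_of_calculus[OF st(2)])
      fix x assume "x \<in> {s..t}"
      with g[of x] sub have "(g has_real_derivative g' x) (at x within {s..t})"
        by (meson DERIV_subset subsetD)
      then show "(g has_vector_derivative g' x) (at x within {s..t})"
        by (simp add: has_real_derivative_iff_has_vector_derivative)
    qed
    have e1: "integral {s..t} (\<lambda>r. (g r - g t) * f r) = integral {s..t} (\<lambda>r. g r * f r) - g t * (F t - F s)"
      using integral_diff[OF int[OF gf] integrable_on_cmult_left[OF int[OF f1], of "g t"]] Fd[of t] st
      by (simp add: left_diff_distrib)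
    have i1: "(\<lambda>r. (g r - g t) * f r) integrable_on {s..t}"
      using integrable_diff[OF int[OF gf] integrable_on_cmult_left[OF int[OF f1], of "g t"]] 
      by (simp add: left_diff_distrib)
    have g'F: "(\<lambda>r. g' r * F s) integrable_on {s..t}" "integral {s..t} (\<lambda>r. g' r * F s) = (g t - g s) * F s"
      using has_integral_mult_left[OF g'_int, of "F s"] by (auto simp: has_integral_iff)
    have e2: "integral {s..t} (\<lambda>r. g' r * (F r - F s)) = integral {s..t} (\<lambda>r. g' r * F r) - (g t - g s) * F s"
      using integral_diff[OF int[OF gF] g'F(1)] g'F(2) by (simp add: right_diff_distrib)
    have i2: "(\<lambda>r. g' r * (F r - F s)) integrable_on {s..t}"
      using integrable_diff[OF int[OF gF] g'F(1)] by (simp add: right_diff_distrib)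
    have d: "\<Phi> t - \<Phi> s = integral {s..t} (\<lambda>r. (g r - g t) * f r) + integral {s..t} (\<lambda>r. g' r * (F r - F s))"
      unfolding \<Phi>_def e1 e2 using integral_diff_Icc[OF gf st] integral_diff_Icc[OF gF st] 
      by (simp add: algebra_simps)
    have b1: "\<bar>integral {s..t} (\<lambda>r. (g r - g t) * f r)\<bar> \<le> L * (t - s) * (V t - V s)"
    proof -
      have bnd: "\<bar>g r - g t\<bar> \<le> L * (t - s)" if "r \<in> {s..t}" for r
      proof -
        have "norm (g t - g r) \<le> L * norm (t - r)"
        proof (rule field_differentiable_bound[where S="{a..b}" and f'=g'])
          show "norm (g' x) \<le> L" if "x \<in> {a..b}" for x using L that by auto
        qed (use g that st in auto)
        also have "\<dots> \<le> L * (t - s)" using that L by (auto intro!: mult_left_mono)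
        finally show ?thesis by (simp add: abs_minus_commute)
      qed
      have "norm (integral {s..t} (\<lambda>r. (g r - g t) * f r)) \<le> integral {s..t} (\<lambda>r. L * (t - s) * \<bar>f r\<bar>)"
        by (rule integral_norm_bound_integral[OF i1])
          (auto simp: abs_mult intro!: mult_right_mono bnd integrable_on_mult_right int[OF f2])
      then show ?thesis using Vd[of t] st by simp
    qed
    have b2: "\<bar>integral {s..t} (\<lambda>r. g' r * (F r - F s))\<bar> \<le> L * (t - s) * (V t - V s)"
    proof -
      have bnd: "\<bar>F r - F s\<bar> \<le> V t - V s" if r: "r \<in> {s..t}" for r
      proof -
        have sr: "{s..r} \<subseteq> {a..b}" and srt: "{s..r} \<subseteq> {s..t}" using r st by auto
        have "norm (integral {s..r} f) \<le> integral {s..r} (\<lambda>r. \<bar>f r\<bar>)"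
          by (rule integral_norm_bound_integral) (auto intro!: integrable_on_subinterval[OF f1 sr] integrable_on_subinterval[OF f2 sr])
        also have "\<dots> \<le> integral {s..t} (\<lambda>r. \<bar>f r\<bar>)"
          by (rule integral_subset_le[OF srt]) (auto intro!: integrable_on_subinterval[OF f2 sr] int[OF f2])
        finally show ?thesis using Fd[of r] Vd[of t] r st by simp
      qed
      have "norm (integral {s..t} (\<lambda>r. g' r * (F r - F s))) \<le> integral {s..t} (\<lambda>r. L * (V t - V s))"
        by (rule integral_norm_bound_integral[OF i2])
          (use sub L in \<open>auto simp: abs_mult intro!: mult_mono bnd\<close>)
      then show ?thesis using st by (simp add: mult.commute mult.left_commute)
    qed
    show "\<bar>\<Phi> t - \<Phi> s\<bar> \<le> (t - s) * (2 * L * V t - 2 * L * V s)"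
      unfolding d using b1 b2 by (simp add: algebra_simps)
  qed
  then show ?thesis by (simp add: \<Phi>_def F_def)
qed

section \<open>Linear second-order systems with irregular forcing\<close>

primrec iterated_integral :: "(real \<Rightarrow> real) \<Rightarrow> nat \<Rightarrow> real \<Rightarrow> real" where
  "iterated_integral F 0 = F"
| "iterated_integral F (Suc k) = (\<lambda>t. integral {0..t} (iterated_integral F k))"

lemma iterated_integral_continuous:
  assumes "continuous_on {0..T} F"
  shows "continuous_on {0..T} (iterated_integral F k)"
  by (induction k) (auto intro: assms indefinite_integral_continuous_1 integrable_continuous_interval)

lemma iterated_integral_deriv:
  assumes "continuous_on {0..T} F" "t \<in> {0..T}"
  shows "(iterated_integral F (Suc k) has_real_derivative iterated_integral F k t) (at t within {0..T})"
  using integral_has_real_derivative[OF iterated_integral_continuous[OF assms(1)] assms(2)] by simp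

lemma iterated_integral_bound:
  assumes F: "continuous_on {0..T} F" and C: "\<And>s. s \<in> {0..T} \<Longrightarrow> \<bar>F s\<bar> \<le> C" and t: "t \<in> {0..T}"
  shows "\<bar>iterated_integral F k t\<bar> \<le> C * t ^ k / fact k"
  using t
proof (induction k arbitrary: t)
  case 0
  then show ?case using C by simp
next
  case (Suc k)
  have sub: "{0..t} \<subseteq> {0..T}" using Suc.prems by auto
  have I: "((\<lambda>s. C * s ^ k / fact k) has_integral C * t ^ Suc k / fact (Suc k)) {0..t}"
  proof -
    have "((\<lambda>s. C * s ^ k / fact k) has_integral C * t ^ Suc k / fact (Suc k) - C * 0 ^ Suc k / fact (Suc k)) {0..t}"
    proof (rule fundamental_theorem_of_calculus)
      fix x assume "x \<in> {0..t}"
      have "((\<lambda>s. C * s ^ Suc k / fact (Suc k)) has_real_derivative C * (real (Suc k) * x ^ k) / fact (Suc k)) (at x within {0..t})"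
        by (rule derivative_eq_intros refl | simp)+
      also have "C * (real (Suc k) * x ^ k) / fact (Suc k) = C * x ^ k / fact k"
        by (simp only: fact_Suc of_nat_mult) (simp add: field_simps del: of_nat_Suc)
      finally show "((\<lambda>s. C * s ^ Suc k / fact (Suc k)) has_vector_derivative C * x ^ k / fact k) (at x within {0..t})"
        by (simp add: has_real_derivative_iff_has_vector_derivative)
    qed (use Suc.prems in simp)
    then show ?thesis by simp
  qed
  have "norm (integral {0..t} (iterated_integral F k)) \<le> integral {0..t} (\<lambda>s. C * s ^ k / fact k)"
  proof (rule integral_norm_bound_integral)
    show "iterated_integral F k integrable_on {0..t}"
      using iterated_integral_continuous[OF F] continuous_on_subset sub integrable_continuous_interval by blast
  qed (use I sub Suc.IH in auto)
  then show ?case unfolding integral_unique[OF I] by simp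
qed

text \<open>
  With geometrically bounded coefficients the factorial in the bound for iterated integrals dominates,
  so the series converges uniformly and may be differentiated term by term. Only every second iterated
  integral occurs, as in the expansion of a second-order flow.
\<close>

lemma iterated_integral_series:
  fixes c :: "nat \<Rightarrow> real"
  assumes T: "0 \<le> T" and F: "continuous_on {0..T} F" and c: "\<And>n. \<bar>c n\<bar> \<le> E * R ^ n"
    and R: "0 \<le> R" and E: "0 \<le> E"
  defines "S \<equiv> \<lambda>k t. \<Sum>n. c n * iterated_integral F (2 * n + k) t"
  shows iterated_integral_series_summable:
      "t \<in> {0..T} \<Longrightarrow> summable (\<lambda>n. c n * iterated_integral F (2 * n + k) t)"
    and iterated_integral_series_deriv:
      "t \<in> {0..T} \<Longrightarrow> (S (Suc k) has_real_derivative S k t) (at t within {0..T})"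
proof -
  have "bounded (F ` {0..T})" by (intro compact_imp_bounded compact_continuous_image F) auto
  then obtain C where C0: "C > 0" and C: "\<And>s. s \<in> {0..T} \<Longrightarrow> \<bar>F s\<bar> \<le> C" unfolding bounded_pos by auto
  define M where "M k n = E * C * T ^ k * ((R * T\<^sup>2) ^ n /\<^sub>R fact n)" for k n
  have Msum: "summable (M k)" for k
    unfolding M_def by (intro summable_mult summable_exp_generic)
  have bd: "norm (c n * iterated_integral F (2 * n + k) t) \<le> M k n" if t: "t \<in> {0..T}" for t n k
  proof -
    have "\<bar>iterated_integral F (2 * n + k) t\<bar> \<le> C * t ^ (2 * n + k) / fact (2 * n + k)"
      by (rule iterated_integral_bound[OF F C t])
    also have "\<dots> \<le> C * T ^ (2 * n + k) / fact n"
      using t C0 T by (intro frac_le mult_left_mono power_mono fact_mono mult_nonneg_nonneg) auto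
    finally have "norm (c n * iterated_integral F (2 * n + k) t) \<le> (E * R ^ n) * (C * T ^ (2 * n + k) / fact n)"
      unfolding real_norm_def abs_mult by (intro mult_mono c) (use E R in auto)
    also have "\<dots> = M k n"
      by (simp add: M_def power_add power_mult power_mult_distrib divide_simps)
    finally show ?thesis .
  qed
  show sm: "summable (\<lambda>n. c n * iterated_integral F (2 * n + k) t)" if "t \<in> {0..T}" for t k
    by (rule summable_comparison_test'[OF Msum]) (rule bd[OF that])
  assume t: "t \<in> {0..T}"
  have "\<exists>g. \<forall>x\<in>{0..T}. (\<lambda>n. c n * iterated_integral F (2 * n + Suc k) x) sums g x \<and>
        (g has_field_derivative S k x) (at x within {0..T})"
  proof (rule has_field_derivative_series)
    show "uniform_limit {0..T} (\<lambda>n x. \<Sum>i<n. c i * iterated_integral F (2 * i + k) x) (S k) sequentially"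
      unfolding S_def by (rule Weierstrass_m_test[OF bd Msum])
    show "((\<lambda>x. c n * iterated_integral F (2 * n + Suc k) x) has_field_derivative
        c n * iterated_integral F (2 * n + k) x) (at x within {0..T})" if "x \<in> {0..T}" for n x
      using DERIV_cmult[OF iterated_integral_deriv[OF F that, of "2 * n + k"], of "c n"] by simp
    show "0 \<in> {0..T}" using T by simp
    then show "summable (\<lambda>n. c n * iterated_integral F (2 * n + Suc k) 0)" by (rule sm)
  qed simp
  then obtain g where g: "\<And>x. x \<in> {0..T} \<Longrightarrow> (\<lambda>n. c n * iterated_integral F (2 * n + Suc k) x) sums g x"
      "(g has_field_derivative S k t) (at t within {0..T})" using t by blast
  show "(S (Suc k) has_real_derivative S k t) (at t within {0..T})"
    by (rule has_field_derivative_transform_within[OF g(2), of 1]) (use t g(1) in \<open>auto simp: S_def sums_iff\<close>)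
qed

text \<open>
  The equation is \<open>u'' = B u + F' e\<close>, written so that \<open>F\<close> need not be differentiable: \<open>u' = v\<close> and
  \<open>(v - F e)' = B u\<close>. Its solution is \<open>u = \<Sum>\<^sub>n B\<^sup>n e I\<^bsup>2n+1\<^esup> F\<close>, where \<open>I\<close> is integration from \<open>0\<close>.
  The choice \<open>F = 1\<close> yields the free motion with initial velocity \<open>e\<close>; taking for \<open>F\<close> the indefinite
  integral of a control yields the controlled motion.
\<close>

lemma linear_second_order_system_solvable:
  fixes B :: "nat \<Rightarrow> nat \<Rightarrow> real" and e :: "nat \<Rightarrow> real"
  assumes T: "0 \<le> T" and F: "continuous_on {0..T} F"
  obtains u v :: "nat \<Rightarrow> real \<Rightarrow> real" where
    "\<And>i. i < N \<Longrightarrow> u i 0 = 0" "\<And>i. i < N \<Longrightarrow> v i 0 = e i * F 0"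
    "\<And>i t. i < N \<Longrightarrow> t \<in> {0..T} \<Longrightarrow> (u i has_real_derivative v i t) (at t within {0..T})"
    "\<And>i t. i < N \<Longrightarrow> t \<in> {0..T} \<Longrightarrow>
       ((\<lambda>s. v i s - e i * F s) has_real_derivative (\<Sum>j<N. B i j * u j t)) (at t within {0..T})"
proof -
  define c where "c n = ((\<lambda>x i. \<Sum>j<N. B i j * x j) ^^ n) e" for n
  have cS: "c (Suc n) i = (\<Sum>j<N. B i j * c n j)" for n i by (simp add: c_def)
  define R where "R = (\<Sum>i<N. \<Sum>j<N. \<bar>B i j\<bar>)"
  define D where "D = (\<Sum>i<N. \<bar>e i\<bar>)"
  have R: "0 \<le> R" and D: "0 \<le> D" by (auto simp: R_def D_def intro!: sum_nonneg)
  have cb: "\<bar>c n i\<bar> \<le> D * R ^ n" if "i < N" for n i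
    using that
  proof (induction n arbitrary: i)
    case 0
    then show ?case by (auto simp: c_def D_def intro!: member_le_sum)
  next
    case (Suc n)
    have "\<bar>c (Suc n) i\<bar> \<le> (\<Sum>j<N. \<bar>B i j * c n j\<bar>)" unfolding cS by (rule sum_abs)
    also have "\<dots> \<le> (\<Sum>j<N. \<bar>B i j\<bar> * (D * R ^ n))"
      by (rule sum_mono) (auto simp: abs_mult intro!: mult_left_mono Suc.IH)
    also have "\<dots> = (\<Sum>j<N. \<bar>B i j\<bar>) * (D * R ^ n)" by (simp add: sum_distrib_right)
    also have "\<dots> \<le> R * (D * R ^ n)"
      unfolding R_def using Suc.prems R D
      by (intro mult_right_mono member_le_sum[where f="\<lambda>i. \<Sum>j<N. \<bar>B i j\<bar>"]) (auto intro!: sum_nonneg simp: R_def)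
    finally show ?case by (simp add: mult_ac)
  qed
  define I where "I = iterated_integral F"
  define S where "S i k t = (\<Sum>n. c n i * I (2 * n + k) t)" for i k t
  define S' where "S' i k t = (\<Sum>n. c (Suc n) i * I (2 * n + k) t)" for i k t
  have cb': "\<bar>c (Suc n) i\<bar> \<le> (D * R) * R ^ n" if "i < N" for n i
    using cb[OF that, of "Suc n"] by (simp add: mult_ac)
  have sm: "summable (\<lambda>n. c n i * I (2 * n + k) t)" if "i < N" "t \<in> {0..T}" for i k t
    unfolding I_def by (rule iterated_integral_series_summable[OF T F cb[OF that(1)] R D that(2)])
  have dS: "(S i (Suc k) has_real_derivative S i k t) (at t within {0..T})" if "i < N" "t \<in> {0..T}" for i k t
    unfolding S_def[abs_def] I_def by (rule iterated_integral_series_deriv[OF T F cb[OF that(1)] R D that(2)])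
  have dS': "(S' i (Suc k) has_real_derivative S' i k t) (at t within {0..T})" if "i < N" "t \<in> {0..T}" for i k t
    unfolding S'_def[abs_def] I_def
    by (rule iterated_integral_series_deriv[OF T F cb'[OF that(1)] R _ that(2)]) (use R D in auto)
  have head: "S i 0 t = e i * F t + S' i 2 t" if "i < N" "t \<in> {0..T}" for i t
    using suminf_split_head[OF sm[OF that, of 0]] by (simp add: S_def S'_def c_def I_def)
  have rec: "S' i 1 t = (\<Sum>j<N. B i j * S j 1 t)" if "t \<in> {0..T}" for i t
  proof -
    have "S' i 1 t = (\<Sum>n. \<Sum>j<N. B i j * (c n j * I (2 * n + 1) t))"
      by (simp add: S'_def cS sum_distrib_right mult.assoc)
    also have "\<dots> = (\<Sum>j<N. \<Sum>n. B i j * (c n j * I (2 * n + 1) t))"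
      by (rule suminf_sum) (use sm[OF _ that, of _ 1] in \<open>auto intro!: summable_mult\<close>)
    also have "\<dots> = (\<Sum>j<N. B i j * S j 1 t)"
      unfolding S_def using sm[OF _ that, of _ 1] by (intro sum.cong refl suminf_mult) auto
    finally show ?thesis .
  qed
  show thesis
  proof
    show "S i 1 0 = 0" for i by (simp add: S_def I_def)
    show "e i * F 0 + S' i 2 0 = e i * F 0" for i by (simp add: S'_def I_def)
    show "(S i 1 has_real_derivative e i * F t + S' i 2 t) (at t within {0..T})" if "i < N" "t \<in> {0..T}" for i t
      using dS[OF that, of 0] head[OF that] by simp
    show "((\<lambda>s. (e i * F s + S' i 2 s) - e i * F s) has_real_derivative (\<Sum>j<N. B i j * S j 1 t)) (at t within {0..T})"
      if "i < N" "t \<in> {0..T}" for i t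
      using dS'[OF that, of 1] rec[OF that(2)] by (simp add: numeral_2_eq_2)
  qed
qed

section \<open>Square-integrable functions on the time interval\<close>

lemma set_integrable_lebesgue_on:
  fixes f :: "real \<Rightarrow> real"
  assumes "S \<in> sets lebesgue"
  shows "f absolutely_integrable_on S \<longleftrightarrow> integrable (lebesgue_on S) f"
  using assms by (simp add: integrable_restrict_space set_integrable_def)

lemma absolutely_integrable_Ioo_iff_Icc:
  fixes f :: "real \<Rightarrow> real"
  shows "f absolutely_integrable_on {a<..<b} \<longleftrightarrow> f absolutely_integrable_on {a..b}"
  using absolutely_integrable_on_open_interval[where f=f and a=a and b=b] by (simp add: box_real)

lemma L2_absolutely_integrable:
  assumes "f \<in> L2 T"
  shows "f absolutely_integrable_on {0..T}"
proof -
  have "integrable (lebesgue_on {0<..<T}) f"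
  proof (rule Bochner_Integration.integrable_bound)
    interpret finite_measure "lebesgue_on {0<..<T}" by (rule finite_measure_lebesgue_on) simp
    show "integrable (lebesgue_on {0<..<T}) (\<lambda>t. 1 + (f t)\<^sup>2)"
      using assms by (auto simp: L2_def)
    have "\<bar>x\<bar> \<le> \<bar>1 + x\<^sup>2\<bar>" for x :: real
    proof -
      have "0 \<le> (\<bar>x\<bar> - 1)\<^sup>2" by simp
      then have "2 * \<bar>x\<bar> \<le> 1 + x\<^sup>2" by (simp add: power2_diff)
      then show ?thesis by simp
    qed
    then show "AE x in lebesgue_on {0<..<T}. norm (f x) \<le> norm (1 + (f x)\<^sup>2)" by simp
  qed (use assms in \<open>simp add: L2_def\<close>)
  then show ?thesis
    by (simp add: set_integrable_lebesgue_on flip: absolutely_integrable_Ioo_iff_Icc)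
qed

lemma L2_inner_eq_integral:
  assumes "f \<in> L2 T" "g \<in> L2 T"
  shows "L2_inner T f g = integral {0..T} (\<lambda>t. f t * g t)"
proof -
  have "integrable (lebesgue_on {0<..<T}) (\<lambda>t. f t * g t)"
  proof (rule Bochner_Integration.integrable_bound)
    show "integrable (lebesgue_on {0<..<T}) (\<lambda>t. (f t)\<^sup>2 + (g t)\<^sup>2)"
      using assms by (auto simp: L2_def)
    have "\<bar>x * y\<bar> \<le> \<bar>x\<^sup>2 + y\<^sup>2\<bar>" for x y :: real
    proof -
      have "0 \<le> (\<bar>x\<bar> - \<bar>y\<bar>)\<^sup>2" by simp
      then have "2 * (\<bar>x\<bar> * \<bar>y\<bar>) \<le> x\<^sup>2 + y\<^sup>2" by (simp add: power2_diff)
      moreover have "0 \<le> \<bar>x\<bar> * \<bar>y\<bar>" by simp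
      ultimately show ?thesis unfolding abs_mult by linarith
    qed
    then show "AE x in lebesgue_on {0<..<T}. norm (f x * g x) \<le> norm ((f x)\<^sup>2 + (g x)\<^sup>2)" by simp
  qed (use assms in \<open>auto simp: L2_def\<close>)
  from lebesgue_integral_eq_integral[OF this] show ?thesis
    by (simp add: L2_inner_def integral_open_interval_real)
qed

lemma continuous_imp_L2:
  assumes "continuous_on {0..T} f"
  shows "f \<in> L2 T"
proof -
  have int: "integrable (lebesgue_on {0<..<T}) g" if "continuous_on {0..T} g" for g :: "real \<Rightarrow> real"
    using absolutely_integrable_continuous_real[OF that]
    by (simp add: set_integrable_lebesgue_on flip: absolutely_integrable_Ioo_iff_Icc)
  have "f \<in> borel_measurable (lebesgue_on {0<..<T})"
    by (rule borel_measurable_integrable[OF int[OF assms]])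
  moreover have "integrable (lebesgue_on {0<..<T}) (\<lambda>t. (f t)\<^sup>2)"
    by (rule int[OF continuous_on_power[OF assms]])
  ultimately show ?thesis by (simp add: L2_def)
qed

lemma L2_inner_self_eq_0:
  assumes T: "0 < T" and h: "continuous_on {0..T} h" and z: "L2_inner T h h = 0" and t: "t \<in> {0..T}"
  shows "h t = 0"
proof -
  have "integral {0..T} (\<lambda>t. h t * h t) = 0"
    using z L2_inner_eq_integral[OF continuous_imp_L2[OF h] continuous_imp_L2[OF h]] by simp
  moreover have "continuous_on {0..T} (\<lambda>t. h t * h t)" using h by (intro continuous_intros)
  ultimately have "\<forall>t\<in>{0..T}. h t * h t = 0"
    using integral_eq_0_iff[of 0 T "\<lambda>t. h t * h t"] T by simp
  then show ?thesis using t by simp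
qed

lemma L2_inner_cong:
  assumes "\<And>t. t \<in> {0<..<T} \<Longrightarrow> f t = f' t" "\<And>t. t \<in> {0<..<T} \<Longrightarrow> g t = g' t"
  shows "L2_inner T f g = L2_inner T f' g'"
  unfolding L2_inner_def by (rule Bochner_Integration.integral_cong) (simp_all add: assms)

lemma L2_cong:
  assumes "\<And>t. t \<in> {0<..<T} \<Longrightarrow> f t = f' t" "f \<in> L2 T"
  shows "f' \<in> L2 T"
proof -
  have "f' \<in> borel_measurable (lebesgue_on {0<..<T}) \<longleftrightarrow> f \<in> borel_measurable (lebesgue_on {0<..<T})"
    by (rule measurable_cong) (simp add: assms(1))
  moreover have "integrable (lebesgue_on {0<..<T}) (\<lambda>t. (f' t)\<^sup>2) \<longleftrightarrow> integrable (lebesgue_on {0<..<T}) (\<lambda>t. (f t)\<^sup>2)"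
    by (rule Bochner_Integration.integrable_cong) (simp_all add: assms(1))
  ultimately show ?thesis using assms by (simp add: L2_def)
qed

section \<open>The string and its free motions\<close>

locale krein_string =
  fixes N :: nat and T :: real and l m :: "nat \<Rightarrow> real"
  assumes N: "1 \<le> N" and T: "0 < T"
    and l: "\<And>i. 1 \<le> i \<Longrightarrow> i \<le> N + 1 \<Longrightarrow> 0 < l i" and m: "\<And>i. 1 \<le> i \<Longrightarrow> i \<le> N \<Longrightarrow> 0 < m i"
begin

abbreviation mass :: "nat \<Rightarrow> real" where "mass i \<equiv> m (Suc i)"

definition stiff :: "nat \<Rightarrow> nat \<Rightarrow> real" where
  "stiff i j = string_A N l $$ (i, j)"

lemma mass_pos: "i < N \<Longrightarrow> 0 < mass i" using m by simp

lemma l1_pos: "0 < l (Suc 0)" using l[of 1] by simp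

lemma stiff_sym: "i < N \<Longrightarrow> j < N \<Longrightarrow> stiff i j = stiff j i"
  by (simp add: stiff_def string_A_def)

lemma index_string_A_mult:
  assumes "i < N" "x \<in> carrier_vec N"
  shows "vec_index (string_A N l *\<^sub>v x) i = (\<Sum>j<N. stiff i j * vec_index x j)"
proof -
  have dim: "dim_row (string_A N l) = N" "dim_col (string_A N l) = N" by (simp_all add: string_A_def)
  show ?thesis using assms dim by (simp add: stiff_def scalar_prod_def atLeast0LessThan)
qed

lemma index_string_M_mult:
  assumes "i < N" "x \<in> carrier_vec N"
  shows "vec_index (string_M N m *\<^sub>v x) i = mass i * vec_index x i"
proof -
  have dim: "dim_row (string_M N m) = N" "dim_col (string_M N m) = N" by (simp_all add: string_M_def)
  have "vec_index (string_M N m *\<^sub>v x) i = (\<Sum>j<N. string_M N m $$ (i, j) * vec_index x j)"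
    using assms dim by (simp add: scalar_prod_def atLeast0LessThan)
  also have "\<dots> = (\<Sum>j<N. if i = j then mass i * vec_index x j else 0)"
    using assms by (intro sum.cong) (auto simp: string_M_def)
  also have "\<dots> = mass i * vec_index x i" using assms by simp
  finally show ?thesis .
qed

lemma state_inner_eq:
  assumes "x \<in> carrier_vec N" "y \<in> carrier_vec N"
  shows "state_inner N m x y = (\<Sum>i<N. mass i * vec_index x i * vec_index y i)"
proof -
  have "state_inner N m x y = (\<Sum>i<N. vec_index (string_M N m *\<^sub>v x) i * vec_index y i)"
    using assms by (simp add: state_inner_def scalar_prod_def atLeast0LessThan)
  also have "\<dots> = (\<Sum>i<N. mass i * vec_index x i * vec_index y i)"
    using assms(1) by (intro sum.cong) (auto simp: index_string_M_mult simp del: index_mult_mat_vec)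
  finally show ?thesis .
qed

text \<open>
  The velocity \<open>p\<close> is carried along with \<open>q\<close> because both enter the pairing identity.
\<close>

definition free_motion :: "(nat \<Rightarrow> real) \<Rightarrow> (nat \<Rightarrow> real \<Rightarrow> real) \<Rightarrow> (nat \<Rightarrow> real \<Rightarrow> real) \<Rightarrow> bool" where
  "free_motion a q p \<longleftrightarrow> (\<forall>i<N. q i 0 = 0 \<and> p i 0 = a i \<and>
     (\<forall>t\<in>{0..T}. (q i has_real_derivative p i t) (at t within {0..T}) \<and>
        (p i has_real_derivative (\<Sum>j<N. stiff i j * q j t) / mass i) (at t within {0..T})))"

lemma free_motion_exists: obtains q p where "free_motion a q p"
proof (rule linear_second_order_system_solvable[OF less_imp_le[OF T] continuous_on_const[of _ 1],
        where e=a and N=N and B="\<lambda>i j. stiff i j / mass i"])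
  fix q p
  assume qp: "\<And>i. i < N \<Longrightarrow> q i 0 = 0" "\<And>i. i < N \<Longrightarrow> p i 0 = a i * 1"
    "\<And>i t. i < N \<Longrightarrow> t \<in> {0..T} \<Longrightarrow> (q i has_real_derivative p i t) (at t within {0..T})"
    "\<And>i t. i < N \<Longrightarrow> t \<in> {0..T} \<Longrightarrow>
       ((\<lambda>s. p i s - a i * 1) has_real_derivative (\<Sum>j<N. stiff i j / mass i * q j t)) (at t within {0..T})"
  have "(p i has_real_derivative (\<Sum>j<N. stiff i j * q j t) / mass i) (at t within {0..T})"
    if "i < N" "t \<in> {0..T}" for i t
    using DERIV_add[OF qp(4)[OF that] DERIV_const[of "a i"]] by (simp add: sum_divide_distrib)
  with qp(1-3) have "free_motion a q p" by (simp add: free_motion_def)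
  then show thesis by (rule that)
qed

lemma
  assumes "free_motion a q p" "i < N" "t \<in> {0..T}" "S \<subseteq> {0..t}"
  shows free_motion_reversed_deriv: "s \<in> {0..t} \<Longrightarrow> ((\<lambda>s. q i (t - s)) has_real_derivative - p i (t - s)) (at s within S)"
    and free_motion_reversed_deriv2: "s \<in> {0..t} \<Longrightarrow> ((\<lambda>s. p i (t - s)) has_real_derivative
      - ((\<Sum>j<N. stiff i j * q j (t - s)) / mass i)) (at s within S)"
proof -
  have rev: "((\<lambda>s. h (t - s)) has_real_derivative - d) (at s within S)"
    if s: "s \<in> {0..t}" and h: "(h has_real_derivative d) (at (t - s) within {0..T})" for h d s
  proof -
    have "((h \<circ> (\<lambda>s. t - s)) has_real_derivative d * (-1)) (at s within S)"
    proof (rule DERIV_image_chain)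
      show "(h has_real_derivative d) (at (t - s) within (\<lambda>s. t - s) ` S)"
        by (rule DERIV_subset[OF h]) (use assms s in auto)
      show "((\<lambda>s. t - s) has_real_derivative -1) (at s within S)"
        by (auto intro!: derivative_eq_intros)
    qed
    then show ?thesis by (simp add: o_def)
  qed
  assume "s \<in> {0..t}"
  moreover from this have "t - s \<in> {0..T}" using assms by auto
  ultimately show "((\<lambda>s. q i (t - s)) has_real_derivative - p i (t - s)) (at s within S)"
    and "((\<lambda>s. p i (t - s)) has_real_derivative
      - ((\<Sum>j<N. stiff i j * q j (t - s)) / mass i)) (at s within S)"
    using assms by (auto simp: free_motion_def intro!: rev)
qed

section \<open>Controlled motions\<close>

definition force_coeff :: "nat \<Rightarrow> real" where
  "force_coeff i = (if i = 0 then 1 / (l 1 * mass 0) else 0)"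

lemma mass_force_coeff: "i < N \<Longrightarrow> mass i * force_coeff i = (if i = 0 then 1 / l 1 else 0)"
  using mass_pos[of i] by (auto simp: force_coeff_def)

lemma equation_of_motion_iff:
  assumes "u \<in> carrier_vec N" "w \<in> carrier_vec N"
  shows "string_M N m *\<^sub>v w = string_A N l *\<^sub>v u + string_force N l x \<longleftrightarrow>
    (\<forall>i<N. vec_index w i = (\<Sum>j<N. stiff i j * vec_index u j) / mass i + force_coeff i * x)"
proof -
  have dM: "dim_vec (string_M N m *\<^sub>v w) = N" and dA: "dim_vec (string_A N l *\<^sub>v u) = N"
    and df: "dim_vec (string_force N l x) = N"
    by (simp_all add: string_M_def string_A_def string_force_def)
  have "string_M N m *\<^sub>v w = string_A N l *\<^sub>v u + string_force N l x \<longleftrightarrow>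
    (\<forall>i<N. vec_index (string_M N m *\<^sub>v w) i =
       vec_index (string_A N l *\<^sub>v u) i + vec_index (string_force N l x) i)"
    unfolding vec_eq_iff dM using dA df by simp
  also have "\<dots> \<longleftrightarrow> (\<forall>i<N. mass i * vec_index w i =
       (\<Sum>j<N. stiff i j * vec_index u j) + (if i = 0 then x / l 1 else 0))"
    using index_string_M_mult[OF _ assms(2)] index_string_A_mult[OF _ assms(1)]
    by (simp add: string_force_def del: index_mult_mat_vec)
  also have "\<dots> \<longleftrightarrow> (\<forall>i<N. vec_index w i = (\<Sum>j<N. stiff i j * vec_index u j) / mass i + force_coeff i * x)"
  proof (intro all_cong)
    fix i assume "i < N"
    from mass_pos[OF this] l1_pos
    show "(mass i * vec_index w i = (\<Sum>j<N. stiff i j * vec_index u j) + (if i = 0 then x / l 1 else 0)) =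
        (vec_index w i = (\<Sum>j<N. stiff i j * vec_index u j) / mass i + force_coeff i * x)"
      by (cases "i = 0") (simp_all add: force_coeff_def field_simps)
  qed
  finally show ?thesis .
qed

text \<open>
  The velocity splits into a continuously differentiable part \<open>z\<close> and the impulse of the control, which
  is only absolutely continuous. Working with \<open>z\<close> keeps all later differentiations classical.
\<close>

lemma string_solution_structure:
  assumes sol: "is_string_solution N l m T f u" and f: "f \<in> L2 T"
  obtains z :: "nat \<Rightarrow> real \<Rightarrow> real" where
    "\<And>i. i < N \<Longrightarrow> vec_index (u 0) i = 0" "\<And>i. i < N \<Longrightarrow> z i 0 = 0"
    "\<And>i t. i < N \<Longrightarrow> t \<in> {0..T} \<Longrightarrow> ((\<lambda>s. vec_index (u s) i) has_real_derivative
       z i t + force_coeff i * integral {0..t} f) (at t within {0..T})"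
    "\<And>i t. i < N \<Longrightarrow> t \<in> {0..T} \<Longrightarrow> (z i has_real_derivative
       (\<Sum>j<N. stiff i j * vec_index (u t) j) / mass i) (at t within {0..T})"
proof -
  from sol have uc: "\<And>t. t \<in> {0..T} \<Longrightarrow> u t \<in> carrier_vec N"
    by (simp add: is_string_solution_def)
  from sol obtain v w where raw: "\<forall>t\<in>{0..T}. v t \<in> carrier_vec N \<and> w t \<in> carrier_vec N"
      "\<forall>i<N. \<forall>t\<in>{0..T}.
        ((\<lambda>s. vec_index (u s) i) has_real_derivative vec_index (v t) i) (at t within {0..T})"
      "\<forall>i<N. integrable (lebesgue_on {0..T}) (\<lambda>s. vec_index (w s) i)"
      "\<forall>i<N. \<forall>t\<in>{0..T}.
        vec_index (v t) i = vec_index (v 0) i + (LINT s|lebesgue_on {0..t}. vec_index (w s) i)"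
    and u0: "u 0 = 0\<^sub>v N" and v0: "v 0 = 0\<^sub>v N"
    and ae: "AE t in lebesgue_on {0..T}.
        string_M N m *\<^sub>v w t = string_A N l *\<^sub>v u t + string_force N l (f t)"
    unfolding is_string_solution_def by (elim conjE exE) (rule that)
  have wc: "w t \<in> carrier_vec N" if "t \<in> {0..T}" for t using raw(1) that by simp
  have du: "((\<lambda>s. vec_index (u s) i) has_real_derivative vec_index (v t) i) (at t within {0..T})"
    if "i < N" "t \<in> {0..T}" for i t using raw(2) that by simp
  have iw: "integrable (lebesgue_on {0..T}) (\<lambda>s. vec_index (w s) i)" if "i < N" for i using raw(3) that by simp
  have v: "vec_index (v t) i = vec_index (v 0) i + (LINT s|lebesgue_on {0..t}. vec_index (w s) i)"
    if "i < N" "t \<in> {0..T}" for i t using raw(4)[rule_format, OF that] .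
  have ucont: "continuous_on {0..T} (\<lambda>s. vec_index (u s) j)" if "j < N" for j
    by (rule DERIV_continuous_on) (rule du[OF that])
  define g where "g i t = (\<Sum>j<N. stiff i j * vec_index (u t) j) / mass i" for i t
  have gc: "continuous_on {0..T} (g i)" for i
    unfolding g_def divide_inverse by (intro continuous_intros ucont) auto
  define Z where "Z = {t \<in> {0..T}. \<not> (string_M N m *\<^sub>v w t = string_A N l *\<^sub>v u t + string_force N l (f t))}"
  have negl: "negligible Z"
  proof -
    have "AE t in lebesgue. t \<in> {0..T} \<longrightarrow> string_M N m *\<^sub>v w t = string_A N l *\<^sub>v u t + string_force N l (f t)"
      using ae by (subst (asm) AE_restrict_space_iff) auto
    then obtain S where "S \<in> null_sets lebesgue" "Z \<subseteq> S"
      unfolding eventually_ae_filter Z_def by (force simp: subset_iff)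
    then show ?thesis using negligible_iff_null_sets negligible_subset by blast
  qed
  have w_eq: "vec_index (w t) i = g i t + force_coeff i * f t" if "i < N" "t \<in> {0..T} - Z" for i t
    using that equation_of_motion_iff[OF uc[of t] wc[of t], of "f t"] by (auto simp: Z_def g_def)
  have fi: "f integrable_on {0..T}"
    using L2_absolutely_integrable[OF f] set_lebesgue_integral_eq_integral(1) by blast
  have v_eq: "vec_index (v t) i = integral {0..t} (g i) + force_coeff i * integral {0..t} f"
    if i: "i < N" and t: "t \<in> {0..T}" for i t
  proof -
    have sub: "{0..t} \<subseteq> {0..T}" using t by auto
    have "(\<lambda>s. vec_index (w s) i) absolutely_integrable_on {0..T}"
      using iw[OF i] by (simp add: set_integrable_lebesgue_on)
    then have "(\<lambda>s. vec_index (w s) i) absolutely_integrable_on {0..t}"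
      by (rule absolutely_integrable_on_subinterval) (use sub in auto)
    then have "(LINT s|lebesgue_on {0..t}. vec_index (w s) i) = integral {0..t} (\<lambda>s. vec_index (w s) i)"
      by (intro lebesgue_integral_eq_integral) (auto simp: set_integrable_lebesgue_on)
    also have "\<dots> = integral {0..t} (\<lambda>s. g i s + force_coeff i * f s)"
      by (rule integral_spike[OF negl]) (use w_eq[OF i] sub in auto)
    also have "\<dots> = integral {0..t} (g i) + integral {0..t} (\<lambda>s. force_coeff i * f s)"
      by (intro Henstock_Kurzweil_Integration.integral_add integrable_on_mult_right
          integrable_on_subinterval[OF fi sub]
          integrable_continuous_interval continuous_on_subset[OF gc sub])
    finally show ?thesis using v[OF i t] v0 i by simp
  qed
  show thesis
  proof (rule that[where z="\<lambda>i t. integral {0..t} (g i)"])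
    show "vec_index (u 0) i = 0" if "i < N" for i using that u0 by simp
    show "((\<lambda>s. vec_index (u s) i) has_real_derivative
       integral {0..t} (g i) + force_coeff i * integral {0..t} f) (at t within {0..T})"
      if "i < N" "t \<in> {0..T}" for i t
      using du[OF that] v_eq[OF that] by simp
    show "((\<lambda>t. integral {0..t} (g i)) has_real_derivative
       (\<Sum>j<N. stiff i j * vec_index (u t) j) / mass i) (at t within {0..T})"
      if "i < N" "t \<in> {0..T}" for i t
      using integral_has_real_derivative[OF gc that(2), of i] by (simp add: g_def)
  qed simp
qed

lemma string_solution_exists:
  assumes f: "f \<in> L2 T"
  obtains u where "is_string_solution N l m T f u"
proof -
  define F where "F t = integral {0..t} f" for t
  have fa: "f absolutely_integrable_on {0..T}" by (rule L2_absolutely_integrable[OF f])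
  then have fi: "f integrable_on {0..T}" using set_lebesgue_integral_eq_integral(1) by blast
  have F: "continuous_on {0..T} F"
    unfolding F_def[abs_def] by (rule indefinite_integral_continuous_1[OF fi])
  have F0: "F 0 = 0" by (simp add: F_def)
  obtain u v where u0: "\<And>i. i < N \<Longrightarrow> u i 0 = 0"
    and v0: "\<And>i. i < N \<Longrightarrow> v i 0 = force_coeff i * F 0"
    and du: "\<And>i t. i < N \<Longrightarrow> t \<in> {0..T} \<Longrightarrow> (u i has_real_derivative v i t) (at t within {0..T})"
    and dv: "\<And>i t. i < N \<Longrightarrow> t \<in> {0..T} \<Longrightarrow> ((\<lambda>s. v i s - force_coeff i * F s) has_real_derivative
         (\<Sum>j<N. stiff i j / mass i * u j t)) (at t within {0..T})"
    by (rule linear_second_order_system_solvable[OF less_imp_le[OF T] F,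
        where e=force_coeff and N=N and B="\<lambda>i j. stiff i j / mass i"]) (rule that)
  have ucont: "continuous_on {0..T} (u j)" if "j < N" for j
    by (rule DERIV_continuous_on) (rule du[OF that])
  define g where "g i t = (\<Sum>j<N. stiff i j * u j t) / mass i" for i t
  define w where "w i t = g i t + force_coeff i * f t" for i t
  have gc: "continuous_on {0..T} (g i)" for i
    unfolding g_def divide_inverse by (intro continuous_intros ucont) auto
  have wa: "w i absolutely_integrable_on {0..T}" for i
    unfolding w_def[abs_def]
    by (intro set_integral_add(1) set_integrable_mult_right fa absolutely_integrable_continuous_real gc)
  have v_eq: "v i t = (LINT s|lebesgue_on {0..t}. w i s)" if i: "i < N" and t: "t \<in> {0..T}" for i t
  proof -
    have sub: "{0..t} \<subseteq> {0..T}" using t by auto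
    have "w i absolutely_integrable_on {0..t}"
      by (rule absolutely_integrable_on_subinterval[OF wa]) (use sub in auto)
    then have "(LINT s|lebesgue_on {0..t}. w i s) = integral {0..t} (w i)"
      by (intro lebesgue_integral_eq_integral) (auto simp: set_integrable_lebesgue_on)
    also have "\<dots> = integral {0..t} (g i) + integral {0..t} (\<lambda>s. force_coeff i * f s)"
      unfolding w_def[abs_def]
      by (intro Henstock_Kurzweil_Integration.integral_add integrable_on_mult_right
          integrable_on_subinterval[OF fi sub]
          integrable_continuous_interval continuous_on_subset[OF gc sub])
    also have "integral {0..t} (g i) = (v i t - force_coeff i * F t) - (v i 0 - force_coeff i * F 0)"
    proof (intro integral_unique fundamental_theorem_of_calculus[where f="\<lambda>s. v i s - force_coeff i * F s"])
      fix x assume x: "x \<in> {0..t}"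
      with sub have "x \<in> {0..T}" by auto
      from DERIV_subset[OF dv[OF i this] sub]
      show "((\<lambda>s. v i s - force_coeff i * F s) has_vector_derivative g i x) (at x within {0..t})"
        by (simp add: has_real_derivative_iff_has_vector_derivative g_def sum_divide_distrib)
    qed (use t in simp)
    finally show ?thesis using v0[OF i] by (simp add: F_def)
  qed
  have "is_string_solution N l m T f (\<lambda>t. vec N (\<lambda>i. u i t))"
    unfolding is_string_solution_def
  proof (rule conjI, simp, rule exI[of _ "\<lambda>t. vec N (\<lambda>i. v i t)"], rule exI[of _ "\<lambda>t. vec N (\<lambda>i. w i t)"],
      intro conjI allI ballI impI)
    show "vec N (\<lambda>i. u i 0) = 0\<^sub>v N" "vec N (\<lambda>i. v i 0) = 0\<^sub>v N"
      using u0 v0 F0 by auto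
    show "((\<lambda>s. vec_index (vec N (\<lambda>i. u i s)) i) has_real_derivative vec_index (vec N (\<lambda>i. v i t)) i)
        (at t within {0..T})" if "i < N" "t \<in> {0..T}" for i t
      using du[OF that] that by simp
    show "integrable (lebesgue_on {0..T}) (\<lambda>s. vec_index (vec N (\<lambda>i. w i s)) i)" if "i < N" for i
      using wa[of i] that by (simp add: set_integrable_lebesgue_on)
    show "vec_index (vec N (\<lambda>i. v i t)) i = vec_index (vec N (\<lambda>i. v i 0)) i +
        (LINT s|lebesgue_on {0..t}. vec_index (vec N (\<lambda>i. w i s)) i)" if "i < N" "t \<in> {0..T}" for i t
      using v_eq[OF that] v0[OF that(1)] that F0 by simp
    have "string_M N m *\<^sub>v vec N (\<lambda>i. w i t) = string_A N l *\<^sub>v vec N (\<lambda>i. u i t) + string_force N l (f t)" for t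
      by (subst equation_of_motion_iff) (simp_all add: w_def g_def)
    then show "AE t in lebesgue_on {0..T}. string_M N m *\<^sub>v vec N (\<lambda>i. w i t) =
        string_A N l *\<^sub>v vec N (\<lambda>i. u i t) + string_force N l (f t)" by simp
  qed simp_all
  then show thesis by (rule that)
qed

text \<open>
  Along \<open>s \<in> [0, t]\<close> the quantity \<open>G(s) = (M z(s), q(t - s)) + (M u(s), p(t - s))\<close> would be
  conserved without forcing, by symmetry of the stiffness matrix. The impulse of the control contributes
  exactly \<open>F(s) p\<^sub>1(t - s) / l\<^sub>1\<close> to its derivative, and an integration by parts moves the derivative from
  the free motion onto \<open>F\<close>.
\<close>

lemma string_solution_pairing:
  assumes sol: "is_string_solution N l m T f u" and f: "f \<in> L2 T"
    and fm: "free_motion a q p" and t: "t \<in> {0..T}"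
  shows "(\<Sum>i<N. mass i * vec_index (u t) i * a i) = integral {0..t} (\<lambda>s. q 0 (t - s) / l 1 * f s)"
proof -
  obtain z where u0: "\<And>i. i < N \<Longrightarrow> vec_index (u 0) i = 0" and z0: "\<And>i. i < N \<Longrightarrow> z i 0 = 0"
    and du: "\<And>i t. i < N \<Longrightarrow> t \<in> {0..T} \<Longrightarrow> ((\<lambda>s. vec_index (u s) i) has_real_derivative
       z i t + force_coeff i * integral {0..t} f) (at t within {0..T})"
    and dz: "\<And>i t. i < N \<Longrightarrow> t \<in> {0..T} \<Longrightarrow> (z i has_real_derivative
       (\<Sum>j<N. stiff i j * vec_index (u t) j) / mass i) (at t within {0..T})"
    by (rule string_solution_structure[OF sol f]) (rule that)
  define U where "U i s = vec_index (u s) i" for i s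
  define F where "F s = integral {0..s} f" for s
  define G where "G s = (\<Sum>i<N. mass i * (z i s * q i (t - s) + U i s * p i (t - s)))" for s
  have sub: "{0..t} \<subseteq> {0..T}" using t by auto
  have fa: "f absolutely_integrable_on {0..t}"
    by (rule absolutely_integrable_on_subinterval[OF L2_absolutely_integrable[OF f]]) (use sub in auto)
  have dG: "(G has_real_derivative F s * p 0 (t - s) / l 1) (at s within {0..t})" if s: "s \<in> {0..t}" for s
  proof -
    define A where "A x i = (\<Sum>j<N. stiff i j * x j)" for x i
    define D where "D i = mass i * (A (\<lambda>j. U j s) i / mass i * q i (t - s) + z i s * - p i (t - s) +
       ((z i s + force_coeff i * F s) * p i (t - s) + U i s * - (A (\<lambda>j. q j (t - s)) i / mass i)))" for i
    have "(G has_real_derivative (\<Sum>i<N. D i)) (at s within {0..t})"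
      unfolding G_def[abs_def]
    proof (rule DERIV_sum)
      fix i assume "i \<in> {..<N}"
      then have i: "i < N" by simp
      have sT: "s \<in> {0..T}" using s sub by auto
      note d = DERIV_subset[OF dz[OF i sT] sub] DERIV_subset[OF du[OF i sT] sub]
        free_motion_reversed_deriv[OF fm i t subset_refl s] free_motion_reversed_deriv2[OF fm i t subset_refl s]
      show "((\<lambda>s. mass i * (z i s * q i (t - s) + U i s * p i (t - s))) has_real_derivative D i) (at s within {0..t})"
        unfolding U_def
        by (rule derivative_eq_intros d refl)+ (simp add: D_def A_def U_def F_def algebra_simps)
    qed
    also have "(\<Sum>i<N. D i) = (\<Sum>i<N. A (\<lambda>j. U j s) i * q i (t - s)) - (\<Sum>i<N. U i s * A (\<lambda>j. q j (t - s)) i)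
        + (\<Sum>i<N. mass i * force_coeff i * (F s * p i (t - s)))"
    proof -
      have "D i = A (\<lambda>j. U j s) i * q i (t - s) - U i s * A (\<lambda>j. q j (t - s)) i
          + mass i * force_coeff i * (F s * p i (t - s))" if "i < N" for i
        using mass_pos[OF that] by (simp add: D_def field_simps)
      then show ?thesis by (simp add: sum.distrib sum_subtractf)
    qed
    also have "(\<Sum>i<N. A (\<lambda>j. U j s) i * q i (t - s)) = (\<Sum>i<N. U i s * A (\<lambda>j. q j (t - s)) i)"
    proof -
      have "(\<Sum>i<N. A (\<lambda>j. U j s) i * q i (t - s)) = (\<Sum>i<N. \<Sum>j<N. stiff i j * U j s * q i (t - s))"
        by (simp add: A_def sum_distrib_right)
      also have "\<dots> = (\<Sum>j<N. \<Sum>i<N. stiff i j * U j s * q i (t - s))" by (rule sum.swap)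
      also have "\<dots> = (\<Sum>j<N. \<Sum>i<N. U j s * (stiff j i * q i (t - s)))"
        by (intro sum.cong refl) (simp add: stiff_sym mult_ac)
      finally show ?thesis by (simp add: A_def sum_distrib_left)
    qed
    also have "(\<Sum>i<N. mass i * force_coeff i * (F s * p i (t - s))) =
        (\<Sum>i<N. if i = 0 then F s * p 0 (t - s) / l 1 else 0)"
      by (intro sum.cong) (auto simp: mass_force_coeff)
    also have "\<dots> = F s * p 0 (t - s) / l 1" using N by simp
    finally show ?thesis by simp
  qed
  have "integral {0..t} (\<lambda>s. F s * p 0 (t - s) / l 1) = G t - G 0"
    by (intro integral_unique fundamental_theorem_of_calculus[where f=G])
      (use t dG in \<open>auto simp: has_real_derivative_iff_has_vector_derivative\<close>)
  also have "\<dots> = (\<Sum>i<N. mass i * vec_index (u t) i * a i)"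
    using u0 z0 fm by (simp add: G_def U_def free_motion_def mult.assoc)
  finally have G: "(\<Sum>i<N. mass i * vec_index (u t) i * a i) = integral {0..t} (\<lambda>s. F s * p 0 (t - s) / l 1)" ..
  have N0: "0 < N" using N by simp
  have pc: "continuous_on {0..t} (\<lambda>s. p 0 (t - s))"
    by (rule DERIV_continuous_on) (rule free_motion_reversed_deriv2[OF fm N0 t subset_refl])
  have "integral {0..t} (\<lambda>s. q 0 (t - s) / l 1 * f s) =
      q 0 (t - t) / l 1 * F t - integral {0..t} (\<lambda>s. - p 0 (t - s) / l 1 * F s)"
    unfolding F_def
  proof (rule absolutely_continuous_integration_by_parts[OF _ fa])
    show "((\<lambda>s. q 0 (t - s) / l 1) has_real_derivative - p 0 (t - s) / l 1) (at s within {0..t})"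
      if "s \<in> {0..t}" for s
      by (rule DERIV_cdivide[OF free_motion_reversed_deriv[OF fm N0 t subset_refl that]])
  qed (use t l1_pos in \<open>auto intro!: continuous_intros pc\<close>)
  also have "\<dots> = integral {0..t} (\<lambda>s. F s * p 0 (t - s) / l 1)"
    using fm N0 by (simp add: free_motion_def mult.commute)
  finally show ?thesis unfolding G ..
qed

text \<open>
  The pairing identity expresses each component of \<open>u t\<close> through the control alone: use the free motion
  with a unit initial velocity.
\<close>

lemma string_solution_unique:
  assumes "is_string_solution N l m T f u" "is_string_solution N l m T f u'" and f: "f \<in> L2 T"
    and t: "t \<in> {0..T}"
  shows "u t = u' t"
proof -
  have c: "u t \<in> carrier_vec N" "u' t \<in> carrier_vec N"
    using assms unfolding is_string_solution_def by auto
  have "vec_index (u t) i = vec_index (u' t) i" if i: "i < N" for i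
  proof -
    obtain q p where fm: "free_motion (\<lambda>j. if j = i then 1 else 0) q p" using free_motion_exists by blast
    have "mass i * vec_index (u t) i = mass i * vec_index (u' t) i"
      using string_solution_pairing[OF assms(1) f fm t] string_solution_pairing[OF assms(2) f fm t] i
      by (simp add: if_distrib cong: if_cong)
    then show ?thesis using mass_pos[OF i] by simp
  qed
  with c show ?thesis by (intro eq_vecI) auto
qed

lemma is_string_solution_cong:
  assumes u: "is_string_solution N l m T f u" and eq: "\<And>t. t \<in> {0..T} \<Longrightarrow> u' t = u t"
  shows "is_string_solution N l m T f u'"
proof -
  from u obtain v w where raw: "\<forall>t\<in>{0..T}. v t \<in> carrier_vec N \<and> w t \<in> carrier_vec N"
      "u 0 = 0\<^sub>v N" "v 0 = 0\<^sub>v N"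
      "\<forall>i<N. \<forall>t\<in>{0..T}.
        ((\<lambda>s. vec_index (u s) i) has_real_derivative vec_index (v t) i) (at t within {0..T})"
      "\<forall>i<N. integrable (lebesgue_on {0..T}) (\<lambda>s. vec_index (w s) i)"
      "\<forall>i<N. \<forall>t\<in>{0..T}.
        vec_index (v t) i = vec_index (v 0) i + (LINT s|lebesgue_on {0..t}. vec_index (w s) i)"
      "AE t in lebesgue_on {0..T}.
        string_M N m *\<^sub>v w t = string_A N l *\<^sub>v u t + string_force N l (f t)"
    unfolding is_string_solution_def by (elim conjE exE) (rule that)
  show ?thesis
    unfolding is_string_solution_def
  proof (intro conjI exI)
    show "\<forall>t\<in>{0..T}. u' t \<in> carrier_vec N"
      using u eq by (simp add: is_string_solution_def)
    show "u' 0 = 0\<^sub>v N" using raw(2) eq[of 0] T by simp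
    show "\<forall>i<N. \<forall>t\<in>{0..T}.
        ((\<lambda>s. vec_index (u' s) i) has_real_derivative vec_index (v t) i) (at t within {0..T})"
    proof (intro allI impI ballI)
      fix i t assume "i < N" and t: "t \<in> {0..T}"
      then have "((\<lambda>s. vec_index (u s) i) has_real_derivative vec_index (v t) i) (at t within {0..T})"
        using raw(4) by blast
      then show "((\<lambda>s. vec_index (u' s) i) has_real_derivative vec_index (v t) i) (at t within {0..T})"
        by (rule has_field_derivative_transform_within[where d=1]) (use t eq in auto)
    qed
    show "AE t in lebesgue_on {0..T}.
        string_M N m *\<^sub>v w t = string_A N l *\<^sub>v u' t + string_force N l (f t)"
      using raw(7) by (rule AE_mp, intro AE_I2) (simp add: eq)
  qed (fact raw)+
qed

lemma is_string_solution_string_solution: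
  assumes f: "f \<in> L2 T"
  shows "is_string_solution N l m T f (string_solution N l m T f)"
proof -
  obtain u where u: "is_string_solution N l m T f u" using string_solution_exists[OF f] .
  have "is_string_solution N l m T f (restrict u {0..T})"
    by (rule is_string_solution_cong[OF u]) simp
  moreover have "w = restrict u {0..T}" if "w \<in> extensional {0..T}" "is_string_solution N l m T f w" for w
    using string_solution_unique[OF that(2) u f] that(1) by (auto simp: extensional_def restrict_def)
  ultimately have "string_solution N l m T f = restrict u {0..T}"
    unfolding string_solution_def by (intro the_equality) auto
  with \<open>is_string_solution N l m T f (restrict u {0..T})\<close> show ?thesis by simp
qed

lemma control_op_carrier: "f \<in> L2 T \<Longrightarrow> control_op N l m T f \<in> carrier_vec N"
  using is_string_solution_string_solution[of f] T by (simp add: control_op_def is_string_solution_def)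

end

section \<open>The adjoint of the control operator\<close>

lemma tderiv_eq:
  assumes "0 < T" "t \<in> {0..T}" "(h has_real_derivative d) (at t within {0..T})"
  shows "tderiv T h t = d"
  unfolding tderiv_def
  by (rule vector_derivative_within_closed_interval)
    (use assms in \<open>simp_all add: has_real_derivative_iff_has_vector_derivative\<close>)

context krein_string begin

lemma free_motion_reversed_continuous:
  assumes "free_motion a q p" "i < N"
  shows "continuous_on {0..T} (\<lambda>s. q i (T - s) / c)"
  unfolding divide_inverse
  by (intro continuous_intros DERIV_continuous_on[where D="\<lambda>s. - p i (T - s)"] free_motion_reversed_deriv[OF assms _ subset_refl])
    (use T in auto)

lemma control_op_pairing:
  assumes x: "x \<in> carrier_vec N" and fm: "free_motion (vec_index x) q p" and g: "g \<in> L2 T"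
  shows "L2_inner T (\<lambda>s. q 0 (T - s) / l 1) g = state_inner N m x (control_op N l m T g)"
proof -
  have c: "continuous_on {0..T} (\<lambda>s. q 0 (T - s) / l 1)"
    by (rule free_motion_reversed_continuous[OF fm]) (use N in simp)
  have "L2_inner T (\<lambda>s. q 0 (T - s) / l 1) g = integral {0..T} (\<lambda>s. q 0 (T - s) / l 1 * g s)"
    by (rule L2_inner_eq_integral[OF continuous_imp_L2[OF c] g])
  also have "\<dots> = (\<Sum>i<N. mass i * vec_index (string_solution N l m T g T) i * vec_index x i)"
    using T by (intro string_solution_pairing[OF is_string_solution_string_solution[OF g] g fm, symmetric]) auto
  also have "\<dots> = state_inner N m x (control_op N l m T g)"
    using state_inner_eq[OF x control_op_carrier[OF g]] by (simp add: control_op_def mult_ac)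
  finally show ?thesis .
qed

text \<open>
  Two continuous functions with the same inner products against all of \<open>L\<^sub>2(0,T)\<close> agree, as one sees by
  testing with their difference; so the function supplied by the pairing identity is the adjoint.
\<close>

lemma control_op_adj_eq:
  assumes x: "x \<in> carrier_vec N" and fm: "free_motion (vec_index x) q p"
  shows "control_op_adj N l m T x = restrict (\<lambda>s. q 0 (T - s) / l 1) {0..T}" (is "_ = ?h")
  unfolding control_op_adj_def
proof (rule the_equality)
  have hc: "continuous_on {0..T} ?h"
    by (rule continuous_on_eq[where f="\<lambda>s. q 0 (T - s) / l 1"], rule free_motion_reversed_continuous[OF fm])
      (use N in auto)
  have h_inner: "L2_inner T ?h g = state_inner N m x (control_op N l m T g)" if "g \<in> L2 T" for g
    using control_op_pairing[OF x fm that] by (subst L2_inner_cong[where f'="\<lambda>s. q 0 (T - s) / l 1" and g'=g]) auto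
  show "?h \<in> extensional {0..T} \<and> continuous_on {0..T} ?h \<and> ?h \<in> L2 T \<and>
        (\<forall>g\<in>L2 T. L2_inner T ?h g = state_inner N m x (control_op N l m T g))"
    using hc h_inner continuous_imp_L2[OF hc] by blast
  fix h
  assume h: "h \<in> extensional {0..T} \<and> continuous_on {0..T} h \<and> h \<in> L2 T \<and>
        (\<forall>g\<in>L2 T. L2_inner T h g = state_inner N m x (control_op N l m T g))"
  define d where "d t = h t - ?h t" for t
  have dc: "continuous_on {0..T} d" unfolding d_def using h hc by (intro continuous_intros) auto
  note dL2 = continuous_imp_L2[OF dc]
  have "L2_inner T d d = integral {0..T} (\<lambda>t. h t * d t - ?h t * d t)"
    by (subst L2_inner_eq_integral[OF dL2 dL2]) (simp add: d_def left_diff_distrib)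
  also have "\<dots> = integral {0..T} (\<lambda>t. h t * d t) - integral {0..T} (\<lambda>t. ?h t * d t)"
    by (intro Henstock_Kurzweil_Integration.integral_diff integrable_continuous_interval continuous_on_mult hc dc)
      (use h in blast)
  also have "\<dots> = L2_inner T h d - L2_inner T ?h d"
    using L2_inner_eq_integral[OF _ dL2, of h] L2_inner_eq_integral[OF continuous_imp_L2[OF hc] dL2] h by simp
  also have "\<dots> = 0" using h h_inner dL2 by simp
  finally have "h t = ?h t" if "t \<in> {0..T}" for t
    using L2_inner_self_eq_0[OF T dc _ that] by (simp add: d_def)
  then show "h = ?h"
    using h by (intro extensionalityI[of _ "{0..T}"]) auto
qed

text \<open>
  Since \<open>M\<^sup>-\<^sup>1 A\<close> is constant in time, applying it to a solution of \<open>q'' = M\<^sup>-\<^sup>1 A q\<close> gives another one.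
\<close>

lemma free_motion_acceleration:
  assumes "free_motion a q p"
  defines "accel \<equiv> \<lambda>x i. (\<Sum>j<N. stiff i j * x j) / mass i"
  shows "free_motion (accel a) (\<lambda>i t. accel (\<lambda>j. q j t) i) (\<lambda>i t. accel (\<lambda>j. p j t) i)"
proof -
  have d: "((\<lambda>t. accel (\<lambda>j. f j t) i) has_real_derivative accel d i) (at t within {0..T})"
    if "\<And>j. j < N \<Longrightarrow> (f j has_real_derivative d j) (at t within {0..T})" for f d i t
    unfolding accel_def by (intro DERIV_cdivide DERIV_sum DERIV_cmult that) simp
  have "((\<lambda>t. accel (\<lambda>j. p j t) i) has_real_derivative accel (accel (\<lambda>j. q j t)) i) (at t within {0..T})"
    if "t \<in> {0..T}" for i t
    by (rule d) (use assms that in \<open>simp add: free_motion_def\<close>)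
  moreover have "((\<lambda>t. accel (\<lambda>j. q j t) i) has_real_derivative accel (\<lambda>j. p j t) i) (at t within {0..T})"
    if "t \<in> {0..T}" for i t
    by (rule d) (use assms that in \<open>simp add: free_motion_def\<close>)
  ultimately show ?thesis
    using assms(1) by (simp add: free_motion_def accel_def)
qed

section \<open>Eigenvectors and the sine space\<close>

text \<open>
  Listing the displacements as \<open>y\<^sub>1, \<dots>, y\<^sub>N\<close> and clamping the ends, \<open>y\<^sub>0 = y\<^bsub>N+1\<^esub> = 0\<close>, turns each row of
  the matrix, the first and last included, into the difference of the slopes on either side of a mass.
\<close>

lemma stiff_row:
  assumes i: "i < N" and y: "y 0 = 0" "y (Suc N) = 0"
  shows "(\<Sum>j<N. stiff i j * y (Suc j)) =
    (y (i + 2) - y (i + 1)) / l (i + 2) - (y (i + 1) - y i) / l (i + 1)"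
proof -
  have "(\<Sum>j<N. stiff i j * y (Suc j)) =
    (\<Sum>j<N. (if j = i then string_b l (i + 1) * y (i + 1) else 0) +
       (if j = Suc i then y (i + 2) / l (i + 2) else 0) + (if i = Suc j then y i / l (i + 1) else 0))"
    using i by (intro sum.cong) (auto simp: stiff_def string_A_def string_a_def)
  also have "\<dots> = string_b l (i + 1) * y (i + 1) + (\<Sum>j<N. if j = Suc i then y (i + 2) / l (i + 2) else 0)
      + (\<Sum>j<N. if i = Suc j then y i / l (i + 1) else 0)"
    using i by (simp add: sum.distrib)
  also have "(\<Sum>j<N. if j = Suc i then y (i + 2) / l (i + 2) else 0) = y (i + 2) / l (i + 2)"
  proof (cases "Suc i < N")
    case False
    with i have "i + 2 = Suc N" by simp
    with y(2) show ?thesis by simp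
  qed simp
  also have "(\<Sum>j<N. if i = Suc j then y i / l (i + 1) else 0) = y i / l (i + 1)"
    using i y(1) by (cases i) auto
  also have "string_b l (i + 1) * y (i + 1) = - y (i + 1) / l (i + 2) - y (i + 1) / l (i + 1)"
    using l[of "i + 1"] l[of "i + 2"] i by (simp add: string_b_def field_simps)
  finally show ?thesis by (simp add: diff_divide_distrib)
qed

text \<open>
  The eigenvalue equation is the recurrence \<open>step\<close> for slopes. If the first component vanishes, it
  propagates zero along the whole string. If the eigenvalue were nonnegative, displacement and slope
  would keep the sign of the first component, contradicting the clamped right end.
\<close>

lemma eigenvector_facts:
  assumes \<phi>: "\<phi> \<in> carrier_vec N" "\<phi> \<noteq> 0\<^sub>v N"
    and eq: "string_A N l *\<^sub>v \<phi> = lam \<cdot>\<^sub>v (string_M N m *\<^sub>v \<phi>)"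
  shows eigenvector_components: "\<And>i. i < N \<Longrightarrow> (\<Sum>j<N. stiff i j * vec_index \<phi> j) / mass i = lam * vec_index \<phi> i"
    and eigenvector_first_nonzero: "vec_index \<phi> 0 \<noteq> 0"
    and eigenvalue_negative: "lam < 0"
proof -
  have comp: "(\<Sum>j<N. stiff i j * vec_index \<phi> j) = lam * (mass i * vec_index \<phi> i)" if "i < N" for i
  proof -
    have "dim_vec (string_M N m *\<^sub>v \<phi>) = N" by (simp add: string_M_def)
    then have "vec_index (string_A N l *\<^sub>v \<phi>) i = lam * vec_index (string_M N m *\<^sub>v \<phi>) i"
      unfolding eq using that by simp
    then show ?thesis
      using index_string_A_mult[OF that \<phi>(1)] index_string_M_mult[OF that \<phi>(1)] by simp
  qed
  show "(\<Sum>j<N. stiff i j * vec_index \<phi> j) / mass i = lam * vec_index \<phi> i" if "i < N" for i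
    using comp[OF that] mass_pos[OF that] by simp
  define y where "y j = (if 1 \<le> j \<and> j \<le> N then vec_index \<phi> (j - 1) else 0)" for j
  have step: "(y (i + 2) - y (i + 1)) / l (i + 2) = (y (i + 1) - y i) / l (i + 1) + lam * mass i * y (i + 1)"
    if "i < N" for i
    using stiff_row[OF that, of y] comp[OF that] that by (simp add: y_def)
  have l': "0 < l (i + 1)" if "i \<le> N" for i using l[of "i + 1"] that by simp
  show nz: "vec_index \<phi> 0 \<noteq> 0"
  proof
    assume "vec_index \<phi> 0 = 0"
    then have y1: "y 1 = 0" by (simp add: y_def)
    have "y i = 0 \<and> y (i + 1) = 0" if "i \<le> N" for i
      using that
    proof (induction i)
      case 0
      then show ?case using y1 by (simp add: y_def)
    next
      case (Suc i)
      then show ?case using step[of i] l'[of "Suc i"] by simp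
    qed
    then have "vec_index \<phi> i = 0" if "i < N" for i
      using that by (metis One_nat_def Suc_leI diff_Suc_1 le_add1 plus_1_eq_Suc y_def less_imp_le)
    with \<phi> show False by (auto intro!: eq_vecI)
  qed
  show "lam < 0"
  proof (rule ccontr)
    assume "\<not> lam < 0"
    then have lam: "0 \<le> lam" by simp
    define \<sigma> where "\<sigma> = y 1"
    have \<sigma>: "\<sigma> \<noteq> 0" using nz N by (simp add: \<sigma>_def y_def)
    have "0 < (y (i + 1) - y i) * \<sigma> \<and> 0 < y (i + 1) * \<sigma>" if "i \<le> N" for i
      using that
    proof (induction i)
      case 0
      have "y 0 = 0" by (simp add: y_def)
      with \<sigma> show ?case by (simp add: \<sigma>_def flip: power2_eq_square)
    next
      case (Suc i)
      then have IH: "0 < (y (i + 1) - y i) * \<sigma>" "0 < y (i + 1) * \<sigma>" and i: "i < N" by auto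
      have "(y (i + 2) - y (i + 1)) * \<sigma> / l (i + 2) =
          (y (i + 1) - y i) * \<sigma> / l (i + 1) + lam * mass i * (y (i + 1) * \<sigma>)"
        using arg_cong[OF step[OF i], of "\<lambda>z. z * \<sigma>"] by (simp add: algebra_simps)
      also have "\<dots> > 0"
        using IH l'[of i] i lam mass_pos[OF i] by (intro add_pos_nonneg) auto
      finally have "0 < (y (i + 2) - y (i + 1)) * \<sigma>"
        using l'[of "Suc i"] i by (simp add: zero_less_divide_iff)
      with IH(2) show ?case by (simp add: left_diff_distrib)
    qed
    from this[of N] show False by (simp add: y_def)
  qed
qed

text \<open>
  An eigenvector \<open>\<phi>\<close> with eigenvalue \<open>\<lambda> < 0\<close> produces the free motion
  \<open>sin(\<surd>\<bar>\<lambda>\<bar> s) / \<surd>\<bar>\<lambda>\<bar> \<phi>\<close> with initial velocity \<open>\<phi>\<close>; its first component can be scaled at will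
  because \<open>\<phi>\<^sub>1 \<noteq> 0\<close>. Superposition gives every element of the sine space.
\<close>

lemma F1_free_motion:
  assumes "f \<in> F1 N l m T"
  obtains x q p where "x \<in> carrier_vec N" "free_motion (vec_index x) q p"
    "\<And>t. t \<in> {0..T} \<Longrightarrow> f t = q 0 (T - t) / l 1"
proof -
  let ?E = "string_eigenvalues N l m"
  from assms obtain c where c: "\<And>t. t \<in> {0..T} \<Longrightarrow>
      f t = (\<Sum>lam\<in>?E. c lam * (sin (sqrt \<bar>lam\<bar> * (T - t)) / sqrt \<bar>lam\<bar>))"
    unfolding F1_def by blast
  have "\<forall>lam\<in>?E. \<exists>\<phi>. \<phi> \<in> carrier_vec N \<and> \<phi> \<noteq> 0\<^sub>v N \<and> string_A N l *\<^sub>v \<phi> = lam \<cdot>\<^sub>v (string_M N m *\<^sub>v \<phi>)"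
    unfolding string_eigenvalues_def by blast
  then obtain \<phi> where \<phi>: "\<And>lam. lam \<in> ?E \<Longrightarrow> \<phi> lam \<in> carrier_vec N" "\<And>lam. lam \<in> ?E \<Longrightarrow> \<phi> lam \<noteq> 0\<^sub>v N"
    "\<And>lam. lam \<in> ?E \<Longrightarrow> string_A N l *\<^sub>v \<phi> lam = lam \<cdot>\<^sub>v (string_M N m *\<^sub>v \<phi> lam)"
    by metis
  define k where "k lam i = l 1 * c lam / vec_index (\<phi> lam) 0 * vec_index (\<phi> lam) i" for lam i
  define q where "q i s = (\<Sum>lam\<in>?E. k lam i * (sin (sqrt \<bar>lam\<bar> * s) / sqrt \<bar>lam\<bar>))" for i s
  define p where "p i s = (\<Sum>lam\<in>?E. k lam i * cos (sqrt \<bar>lam\<bar> * s))" for i s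
  define x where "x = vec N (\<lambda>i. \<Sum>lam\<in>?E. k lam i)"
  have neg: "lam < 0" if "lam \<in> ?E" for lam using eigenvalue_negative[OF \<phi>[OF that]] .
  have accel: "(\<Sum>j<N. stiff i j * q j s) / mass i = (\<Sum>lam\<in>?E. k lam i * - (sqrt \<bar>lam\<bar> * sin (sqrt \<bar>lam\<bar> * s)))"
    if i: "i < N" for i s
  proof -
    have "(\<Sum>j<N. stiff i j * q j s) / mass i =
        (\<Sum>j<N. \<Sum>lam\<in>?E. stiff i j * k lam j * (sin (sqrt \<bar>lam\<bar> * s) / sqrt \<bar>lam\<bar>)) / mass i"
      by (simp add: q_def sum_distrib_left mult.assoc)
    also have "\<dots> = (\<Sum>lam\<in>?E. (\<Sum>j<N. stiff i j * k lam j) * (sin (sqrt \<bar>lam\<bar> * s) / sqrt \<bar>lam\<bar>)) / mass i"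
      by (subst sum.swap) (simp only: sum_distrib_right)
    also have "\<dots> = (\<Sum>lam\<in>?E. (\<Sum>j<N. stiff i j * k lam j) / mass i * (sin (sqrt \<bar>lam\<bar> * s) / sqrt \<bar>lam\<bar>))"
      by (subst sum_divide_distrib) (simp add: mult.commute)
    also have "\<dots> = (\<Sum>lam\<in>?E. k lam i * - (sqrt \<bar>lam\<bar> * sin (sqrt \<bar>lam\<bar> * s)))"
    proof (rule sum.cong[OF refl])
      fix lam assume lam: "lam \<in> ?E"
      have "(\<Sum>j<N. stiff i j * k lam j) / mass i =
          l 1 * c lam / vec_index (\<phi> lam) 0 * ((\<Sum>j<N. stiff i j * vec_index (\<phi> lam) j) / mass i)"
        by (simp add: k_def sum_distrib_left sum_divide_distrib mult_ac)
      also have "\<dots> = lam * k lam i"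
        unfolding eigenvector_components[OF \<phi>[OF lam] i] by (simp add: k_def)
      finally have e: "(\<Sum>j<N. stiff i j * k lam j) / mass i = lam * k lam i" .
      have r: "lam / sqrt \<bar>lam\<bar> = - sqrt \<bar>lam\<bar>"
        using neg[OF lam] real_div_sqrt[of "\<bar>lam\<bar>"] by simp
      have "(\<Sum>j<N. stiff i j * k lam j) / mass i * (sin (sqrt \<bar>lam\<bar> * s) / sqrt \<bar>lam\<bar>) =
          k lam i * (lam / sqrt \<bar>lam\<bar> * sin (sqrt \<bar>lam\<bar> * s))"
        unfolding e by simp
      then show "(\<Sum>j<N. stiff i j * k lam j) / mass i * (sin (sqrt \<bar>lam\<bar> * s) / sqrt \<bar>lam\<bar>) =
          k lam i * - (sqrt \<bar>lam\<bar> * sin (sqrt \<bar>lam\<bar> * s))"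
        unfolding r by simp
    qed
    finally show ?thesis .
  qed
  have "free_motion (vec_index x) q p"
    unfolding free_motion_def
  proof (intro allI impI conjI ballI)
    fix i t assume i: "i < N"
    show "q i 0 = 0" by (simp add: q_def)
    show "p i 0 = vec_index x i" using i by (simp add: p_def x_def)
    show "(q i has_real_derivative p i t) (at t within {0..T})"
      unfolding q_def[abs_def] p_def
    proof (rule DERIV_sum)
      fix lam assume "lam \<in> ?E"
      then have "sqrt \<bar>lam\<bar> \<noteq> 0" using neg[of lam] by simp
      moreover have "((\<lambda>s. c * (sin (r * s) / r)) has_real_derivative c * cos (r * t)) (at t within {0..T})"
        if "r \<noteq> 0" for c r
        using that by (auto intro!: derivative_eq_intros)
      ultimately show "((\<lambda>s. k lam i * (sin (sqrt \<bar>lam\<bar> * s) / sqrt \<bar>lam\<bar>)) has_real_derivative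
          k lam i * cos (sqrt \<bar>lam\<bar> * t)) (at t within {0..T})" by blast
    qed
    show "(p i has_real_derivative (\<Sum>j<N. stiff i j * q j t) / mass i) (at t within {0..T})"
      unfolding p_def[abs_def] accel[OF i]
      by (rule DERIV_sum) (auto intro!: derivative_eq_intros)
  qed
  moreover have "f t = q 0 (T - t) / l 1" if t: "t \<in> {0..T}" for t
  proof -
    have "k lam 0 = l 1 * c lam" if "lam \<in> ?E" for lam
      using eigenvector_first_nonzero[OF \<phi>[OF that]] by (simp add: k_def)
    then show ?thesis
      using c[OF t] l1_pos by (simp add: q_def sum_divide_distrib)
  qed
  moreover have "x \<in> carrier_vec N" by (simp add: x_def)
  ultimately show thesis using that by blast
qed

lemma state_inner_delta_state:
  assumes "x \<in> carrier_vec N" "k \<in> {1..N}"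
  shows "state_inner N m x (delta_state N m k) = vec_index x (k - 1)"
proof -
  have carrier: "delta_state N m k \<in> carrier_vec N" by (simp add: delta_state_def)
  have "state_inner N m x (delta_state N m k) = (\<Sum>i<N. if i = k - 1 then vec_index x (k - 1) else 0)"
    unfolding state_inner_eq[OF assms(1) carrier]
  proof (rule sum.cong[OF refl])
    fix i assume "i \<in> {..<N}"
    then show "mass i * vec_index x i * vec_index (delta_state N m k) i =
        (if i = k - 1 then vec_index x (k - 1) else 0)"
      using assms(2) mass_pos[of i] by (auto simp: delta_state_def)
  qed
  also have "\<dots> = vec_index x (k - 1)" using assms(2) by auto
  finally show ?thesis .
qed

end

section \<open>Recovery of the parameters\<close>

theorem mainTheorem5:
  fixes N :: nat and T :: real and l m :: "nat \<Rightarrow> real" and f :: "nat \<Rightarrow> real \<Rightarrow> real"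
  assumes "N \<ge> 1" and "T > 0"
    and "\<forall>i\<in>{1..N+1}. l i > 0"
    and "\<forall>i\<in>{1..N}. m i > 0"
    and "\<forall>k\<in>{1..N}. f k \<in> F1 N l m T \<and> control_op N l m T (f k) = delta_state N m k"
  shows "l 1 = - ((L2_norm T (f 1))\<^sup>2 / tderiv T (f 1) T) \<and>
    (\<forall>k\<in>{1..N}. m k = 1 / L2_inner T (connecting_op N l m T (f k)) (f k)) \<and>
    (\<forall>k\<in>{1..N}. string_b l k =
       (m k)\<^sup>2 * L2_inner T (tderiv T (tderiv T (connecting_op N l m T (f k)))) (f k))"
proof -
  interpret krein_string N T l m by unfold_locales (use assms in auto)
  have N0: "0 < N" using N by simp
  have f_L2: "f k \<in> L2 T" if k: "k \<in> {1..N}" for k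
  proof -
    from assms(5) k have "f k \<in> F1 N l m T" by blast
    then obtain x q p where x: "x \<in> carrier_vec N" and fm: "free_motion (vec_index x) q p"
      and f: "\<And>t. t \<in> {0..T} \<Longrightarrow> f k t = q 0 (T - t) / l 1" by (rule F1_free_motion) (rule that) 
    show ?thesis
      by (rule L2_cong[OF _ continuous_imp_L2[OF free_motion_reversed_continuous[OF fm N0, of "l 1"]]])
        (use f in auto)
  qed
  have pairing: "L2_inner T h (f k) = vec_index x (k - 1)"
    if k: "k \<in> {1..N}" and x: "x \<in> carrier_vec N" and fm: "free_motion (vec_index x) q p"
      and h: "\<And>t. t \<in> {0<..<T} \<Longrightarrow> h t = q 0 (T - t) / l 1" for k x q p h
  proof -
    have "L2_inner T h (f k) = L2_inner T (\<lambda>t. q 0 (T - t) / l 1) (f k)"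
      by (rule L2_inner_cong) (simp_all add: h)
    also have "\<dots> = state_inner N m x (delta_state N m k)"
      using control_op_pairing[OF x fm f_L2[OF k]] assms(5) k by simp
    finally show ?thesis using state_inner_delta_state[OF x k] by simp
  qed
  have part1: "l 1 = - ((L2_norm T (f 1))\<^sup>2 / tderiv T (f 1) T)"
  proof -
    have k: "1 \<in> {1..N}" using N by simp
    from assms(5) k have "f 1 \<in> F1 N l m T" by blast
    then obtain x q p where x: "x \<in> carrier_vec N" and fm: "free_motion (vec_index x) q p"
      and f: "\<And>t. t \<in> {0..T} \<Longrightarrow> f 1 t = q 0 (T - t) / l 1" by (rule F1_free_motion) (rule that)
    have inner: "L2_inner T (f 1) (f 1) = vec_index x 0"
      using pairing[OF k x fm, of "f 1"] f by simp
    have "0 \<le> L2_inner T (f 1) (f 1)" by (simp add: L2_inner_def)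
    then have norm: "(L2_norm T (f 1))\<^sup>2 = vec_index x 0" by (simp add: L2_norm_def flip: inner)
    have TT: "T \<in> {0..T}" using T by simp
    have "((\<lambda>t. q 0 (T - t) / l 1) has_real_derivative - p 0 (T - T) / l 1) (at T within {0..T})"
      by (rule DERIV_cdivide[OF free_motion_reversed_deriv[OF fm N0 TT subset_refl TT]])
    then have "(f 1 has_real_derivative - p 0 (T - T) / l 1) (at T within {0..T})"
      by (rule has_field_derivative_transform_within[where d=1]) (use f TT in auto)
    then have deriv: "tderiv T (f 1) T = - vec_index x 0 / l 1"
      using tderiv_eq[OF T TT] fm N0 by (simp add: free_motion_def)
    have "vec_index x 0 \<noteq> 0"
    \<comment> \<open>Otherwise \<open>f 1\<close> vanishes on \<open>[0,T]\<close>, but a zero control pairs to \<open>0\<close> with every free motion.\<close>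
    proof
      assume "vec_index x 0 = 0"
      have fc: "continuous_on {0..T} (f 1)"
        by (rule continuous_on_eq[OF free_motion_reversed_continuous[OF fm N0, of "l 1"]]) (use f in auto)
      have f0: "f 1 t = 0" if "t \<in> {0..T}" for t
        using L2_inner_self_eq_0[OF T fc _ that] inner \<open>vec_index x 0 = 0\<close> by simp
      obtain q' p' where fm': "free_motion (vec_index (vec N (\<lambda>i. 1))) q' p'" using free_motion_exists .
      have "L2_inner T (\<lambda>t. q' 0 (T - t) / l 1) (f 1) = vec_index (vec N (\<lambda>i. 1)) 0"
        using pairing[OF k _ fm'] by simp
      moreover have "L2_inner T (\<lambda>t. q' 0 (T - t) / l 1) (f 1) = L2_inner T (\<lambda>t. q' 0 (T - t) / l 1) (\<lambda>t. 0)"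
        by (rule L2_inner_cong) (use f0 in auto)
      ultimately show False using N0 by (simp add: L2_inner_def)
    qed
    then show ?thesis unfolding norm deriv using l1_pos by simp
  qed
  have rest: "m k = 1 / L2_inner T (connecting_op N l m T (f k)) (f k) \<and>
      string_b l k = (m k)\<^sup>2 * L2_inner T (tderiv T (tderiv T (connecting_op N l m T (f k)))) (f k)"
    if k: "k \<in> {1..N}" for k
  proof -
    let ?d = "delta_state N m k"
    have d: "?d \<in> carrier_vec N" by (simp add: delta_state_def)
    have mk: "0 < m k" using m k by simp
    have kN: "k - 1 < N" and Sk: "Suc (k - 1) = k" using k by auto
    obtain q p where fm: "free_motion (vec_index ?d) q p" using free_motion_exists .
    define h where "h = connecting_op N l m T (f k)"
    have h: "h = restrict (\<lambda>s. q 0 (T - s) / l 1) {0..T}"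
      using control_op_adj_eq[OF d fm] assms(5) k by (simp add: h_def connecting_op_def)
    have "L2_inner T h (f k) = vec_index ?d (k - 1)"
      by (rule pairing[OF k d fm]) (simp add: h)
    then have c: "L2_inner T h (f k) = 1 / m k" using k kN by (simp add: delta_state_def)
    let ?acc = "\<lambda>x i. (\<Sum>j<N. stiff i j * x j) / mass i"
    have d1: "tderiv T h t = - p 0 (T - t) / l 1" if t: "t \<in> {0..T}" for t
    proof (rule tderiv_eq[OF T t])
      have TT: "T \<in> {0..T}" using T by simp
      show "(h has_real_derivative - p 0 (T - t) / l 1) (at t within {0..T})"
        by (rule has_field_derivative_transform_within[OF
              DERIV_cdivide[OF free_motion_reversed_deriv[OF fm N0 TT subset_refl t]], where d=1])
          (use t in \<open>auto simp: h\<close>)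
    qed
    have d2: "tderiv T (tderiv T h) t = ?acc (\<lambda>j. q j (T - t)) 0 / l 1" if t: "t \<in> {0..T}" for t
    proof (rule tderiv_eq[OF T t])
      have TT: "T \<in> {0..T}" using T by simp
      have "((\<lambda>t. - p 0 (T - t) / l 1) has_real_derivative - (- ?acc (\<lambda>j. q j (T - t)) 0) / l 1) (at t within {0..T})"
        by (rule DERIV_cdivide[OF DERIV_minus[OF free_motion_reversed_deriv2[OF fm N0 TT subset_refl t]]])
      then have "((\<lambda>t. - p 0 (T - t) / l 1) has_real_derivative ?acc (\<lambda>j. q j (T - t)) 0 / l 1) (at t within {0..T})"
        by simp
      then show "(tderiv T h has_real_derivative ?acc (\<lambda>j. q j (T - t)) 0 / l 1) (at t within {0..T})"
        by (rule has_field_derivative_transform_within[where d=1]) (use t d1 in auto)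
    qed
    define x where "x = vec N (?acc (vec_index ?d))"
    have x: "x \<in> carrier_vec N" by (simp add: x_def)
    have "free_motion (vec_index x) (\<lambda>i t. ?acc (\<lambda>j. q j t) i) (\<lambda>i t. ?acc (\<lambda>j. p j t) i)"
      using free_motion_acceleration[OF fm] unfolding free_motion_def by (simp add: x_def)
    from pairing[OF k x this, of "tderiv T (tderiv T h)"]
    have "L2_inner T (tderiv T (tderiv T h)) (f k) = vec_index x (k - 1)"
      using d2 by simp
    also have "\<dots> = (\<Sum>j<N. stiff (k - 1) j * (if j = k - 1 then 1 / m k else 0)) / m k"
      using kN k by (auto simp: x_def delta_state_def intro!: sum.cong)
    also have "\<dots> = (\<Sum>j<N. if j = k - 1 then stiff (k - 1) j / m k else 0) / m k"
      by (intro arg_cong2[where f="(/)"] sum.cong) auto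
    also have "\<dots> = string_b l k / (m k)\<^sup>2"
      using kN Sk by (simp add: stiff_def string_A_def power2_eq_square)
    finally show ?thesis using c mk by (simp add: h_def)
  qed
  from part1 rest show ?thesis by blast
qed

end
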